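(* Let $k$ be a field of characteristic zero and let $\mathbf{G}$ be a linear algebraic $k$-group of positive dimension. Assume that $\mathbf{G}$ is connected and is not presentable by a product (as an algebraic $k$-group). Then every Zariski dense subgroup of $\mathbf{G}(k)$ is not presentable by a product (as an abstract group).
   Context: $\mathbf{G}(k)$ denotes the group of $k$-points of $\mathbf{G}$. A connected linear algebraic $k$-group $\mathbf{G}$ is presentable by a product if there exist two commuting connected closed $k$-subgroups $\mathbf{G}_1,\mathbf{G}_2$ of $\mathbf{G}$, both of positive dimension, such that the multiplication homomorphism $\mathbf{G}_1\times\mathbf{G}_2\longrightarrow\mathbf{G}$, $(g_1,g_2)\longmapsto g_1g_2$, is onto. An infinite abstract group $\Gamma$ is presentable by a product if there exist groups $\Gamma_1,\Gamma_2$ and a homomorphism $\varphi\colon\Gamma_1\times\Gamma_2\longrightarrow\Gamma$ such that $\varphi(\Gamma_1\times\{1\})$ and $\varphi(\{1\}\times\Gamma_2)$ are both infinite and $\varphi(\Gamma_1\times\Gamma_2)$ is of finite index in $\Gamma$. *)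

theory Defs
  imports
    "HOL-Analysis.Analysis"
    "HOL-Library.Poly_Mapping"
    "HOL-Algebra.Coset"
    "HOL-Algebra.Algebraic_Closure_Type"
begin

no_notation eq_closure_of (\<open>closure'_of\<index>\<close>)

(* Conventions: K is the algebraically closed field given by the type 'a, and k is a subfield
   of K.  A linear algebraic k-group is a Zariski closed subgroup of GL_n(K), n = CARD('n), that
   is defined over k; it is identified with its group of K-points. *)

section \<open>Polynomials in the matrix entries\<close>

type_synonym ('v, 'a) mpoly = "('v \<Rightarrow>\<^sub>0 nat) \<Rightarrow>\<^sub>0 'a"

definition mpoly_eval :: "('v \<Rightarrow> 'a) \<Rightarrow> ('v, 'a::comm_ring_1) mpoly \<Rightarrow> 'a" where
  "mpoly_eval x p = (\<Sum>m\<in>Poly_Mapping.keys p.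
     Poly_Mapping.lookup p m *
     (\<Prod>v\<in>Poly_Mapping.keys m. x v ^ Poly_Mapping.lookup m v))"

definition mat_eval :: "'a^'n^'n \<Rightarrow> ('n \<times> 'n, 'a::comm_ring_1) mpoly \<Rightarrow> 'a" where
  "mat_eval A = mpoly_eval (\<lambda>(i, j). A $ i $ j)"

definition polys_over :: "'a set \<Rightarrow> ('v, 'a::zero) mpoly set" where
  "polys_over k = {p. \<forall>m. Poly_Mapping.lookup p m \<in> k}"

definition zero_locus :: "('n \<times> 'n, 'a::comm_ring_1) mpoly set \<Rightarrow> ('a^'n^'n) set" where
  "zero_locus S = {A. \<forall>p\<in>S. mat_eval A p = 0}"

definition vanishing_ideal :: "('a^'n^'n) set \<Rightarrow> ('n \<times> 'n, 'a::comm_ring_1) mpoly set" where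
  "vanishing_ideal V = {p. \<forall>A\<in>V. mat_eval A p = 0}"

lemma mpoly_eval_superset:
  assumes "finite M" "Poly_Mapping.keys p \<subseteq> M"
  shows "mpoly_eval x p = (\<Sum>m\<in>M. Poly_Mapping.lookup p m *
     (\<Prod>v\<in>Poly_Mapping.keys m. x v ^ Poly_Mapping.lookup m v))"
  unfolding mpoly_eval_def
  by (rule sum.mono_neutral_left) (use assms in \<open>auto simp: in_keys_iff\<close>)

lemma mpoly_eval_add: "mpoly_eval x (p + q) = mpoly_eval x p + mpoly_eval x q"
proof -
  let ?M = "Poly_Mapping.keys p \<union> Poly_Mapping.keys q"
  have "Poly_Mapping.keys (p + q) \<subseteq> ?M" by (rule Poly_Mapping.keys_add)
  then show ?thesis
    by (simp add: mpoly_eval_superset[of ?M] lookup_add algebra_simps sum.distrib)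
qed

lemma mpoly_eval_zero [simp]: "mpoly_eval x 0 = 0"
  by (simp add: mpoly_eval_def)

lemma mpoly_eval_single:
  "mpoly_eval x (Poly_Mapping.single m c) =
     c * (\<Prod>v\<in>Poly_Mapping.keys m. x v ^ Poly_Mapping.lookup m v)"
  by (subst mpoly_eval_superset[of "{m}"]) auto

lemma monomial_eval_add:
  fixes x :: "'v \<Rightarrow> 'a::comm_ring_1" and m l :: "'v \<Rightarrow>\<^sub>0 nat"
  shows "(\<Prod>v\<in>Poly_Mapping.keys (m + l). x v ^ Poly_Mapping.lookup (m + l) v) =
     (\<Prod>v\<in>Poly_Mapping.keys m. x v ^ Poly_Mapping.lookup m v) *
     (\<Prod>v\<in>Poly_Mapping.keys l. x v ^ Poly_Mapping.lookup l v)"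
proof -
  let ?M = "Poly_Mapping.keys m \<union> Poly_Mapping.keys l"
  have ext: "(\<Prod>v\<in>Poly_Mapping.keys u. x v ^ Poly_Mapping.lookup u v) =
      (\<Prod>v\<in>?M. x v ^ Poly_Mapping.lookup u v)"
    if "Poly_Mapping.keys u \<subseteq> ?M" for u :: "'v \<Rightarrow>\<^sub>0 nat"
    by (rule prod.mono_neutral_left) (use that in \<open>auto simp: in_keys_iff\<close>)
  show ?thesis
    unfolding ext[OF Poly_Mapping.keys_add] ext[OF Un_upper1] ext[OF Un_upper2]
    by (simp add: lookup_add power_add prod.distrib)
qed

lemma mpoly_induct [case_names zero add]:
  assumes "P 0" and add: "\<And>m c p. P p \<Longrightarrow> P (Poly_Mapping.single m c + p)"
  shows "P (p :: 'b \<Rightarrow>\<^sub>0 'a::comm_monoid_add)"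
proof (induction p rule: update_induct)
  case (update p m c)
  have "Poly_Mapping.update m c p = Poly_Mapping.single m c + p"
    by (rule poly_mapping_eqI)
      (use update(1) in \<open>auto simp: lookup_update lookup_add lookup_single in_keys_iff when_def\<close>)
  with add[OF update(3)] show ?case by simp
qed (fact assms(1))

lemma mpoly_eval_mult: "mpoly_eval x (p * q) = mpoly_eval x p * mpoly_eval x q"
proof (induction p rule: mpoly_induct)
  case (add m c p)
  have "mpoly_eval x (Poly_Mapping.single m c * q) =
      mpoly_eval x (Poly_Mapping.single m c) * mpoly_eval x q"
  proof (induction q rule: mpoly_induct)
    case (add l d q)
    then show ?case
      by (simp add: distrib_left mpoly_eval_add mult_single mpoly_eval_single
          monomial_eval_add mult_ac)
  qed simp
  with add show ?case by (simp add: distrib_right mpoly_eval_add)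
qed simp

lemma mat_eval_mult: "mat_eval A (p * q) = mat_eval A p * mat_eval A q"
  by (simp add: mat_eval_def mpoly_eval_mult)

lemma mat_eval_one: "mat_eval A 1 = 1"
  by (simp add: mat_eval_def mpoly_eval_def flip: single_one)


section \<open>The Zariski topology\<close>

definition zariski :: "('a::field^'n^'n) topology" where
  "zariski = topology (\<lambda>U. \<exists>S. U = - zero_locus S)"

lemma istopology_zariski: "istopology (\<lambda>U :: ('a::field^'n^'n) set. \<exists>S. U = - zero_locus S)"
  unfolding istopology_def
proof (intro conjI allI impI)
  fix U V :: "('a^'n^'n) set"
  assume "\<exists>S. U = - zero_locus S" "\<exists>S. V = - zero_locus S"
  then obtain S T where UV: "U = - zero_locus S" "V = - zero_locus T" by blast
  have "U \<inter> V = - zero_locus {p * q | p q. p \<in> S \<and> q \<in> T}"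
    unfolding UV zero_locus_def by (fastforce simp: mat_eval_mult)
  then show "\<exists>S. U \<inter> V = - zero_locus S" by blast
next
  fix \<U> :: "('a^'n^'n) set set"
  assume "\<forall>U\<in>\<U>. \<exists>S. U = - zero_locus S"
  then obtain f where f: "\<And>U. U \<in> \<U> \<Longrightarrow> U = - zero_locus (f U)" by metis
  have "\<Union>\<U> = (\<Union>U\<in>\<U>. - zero_locus (f U))" using f by auto
  also have "\<dots> = - zero_locus (\<Union>U\<in>\<U>. f U)" by (auto simp: zero_locus_def)
  finally show "\<exists>S. \<Union>\<U> = - zero_locus S" by blast
qed

lemma openin_zariski: "openin zariski U \<longleftrightarrow> (\<exists>S. U = - zero_locus S)"
  unfolding zariski_def by (simp add: topology_inverse'[OF istopology_zariski])

lemma topspace_zariski [simp]: "topspace zariski = UNIV"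
proof -
  have "openin zariski (- zero_locus {1})" by (auto simp: openin_zariski)
  moreover have "- zero_locus {1} = (UNIV :: ('a::field^'n^'n) set)"
    by (auto simp: zero_locus_def mat_eval_one)
  ultimately show ?thesis by (metis openin_subset top.extremum_uniqueI)
qed

lemma closedin_zariski: "closedin zariski V \<longleftrightarrow> (\<exists>S. V = zero_locus S)"
proof -
  have "closedin zariski V \<longleftrightarrow> openin zariski (- V)"
    by (simp add: closedin_def Compl_eq_Diff_UNIV)
  then show ?thesis
    by (simp add: openin_zariski)
qed

definition irreducible_space :: "'a topology \<Rightarrow> bool" where
  "irreducible_space T \<longleftrightarrow> topspace T \<noteq> {} \<and>
     (\<forall>A B. closedin T A \<and> closedin T B \<and> topspace T = A \<union> B
        \<longrightarrow> A = topspace T \<or> B = topspace T)"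

(* Krull dimension; for a Zariski closed set this is the usual dimension of a variety.
   The supremum over the empty set is 0, so the empty space gets dimension 0. *)
definition krull_dim :: "'a topology \<Rightarrow> enat" where
  "krull_dim T = Sup {enat n | n. \<exists>Z :: nat \<Rightarrow> 'a set.
     (\<forall>i\<le>n. closedin T (Z i) \<and> irreducible_space (subtopology T (Z i))) \<and>
     (\<forall>i<n. Z i \<subset> Z (Suc i))}"

definition zariski_dim :: "('a::field^'n^'n) set \<Rightarrow> enat" where
  "zariski_dim V = krull_dim (subtopology zariski V)"


section \<open>Linear algebraic groups\<close>

definition GL :: "('a::field^'n^'n) monoid" where
  "GL = \<lparr>carrier = {A. invertible A}, monoid.mult = matrix_matrix_mult, one = mat 1\<rparr>"

lemma group_GL: "group (GL :: ('a::field^'n^'n) monoid)"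
proof (rule groupI)
  show "\<one>\<^bsub>GL\<^esub> \<in> carrier (GL :: ('a^'n^'n) monoid)"
    unfolding GL_def invertible_def by (auto intro!: exI[of _ "mat 1"])
next
  fix A B :: "'a^'n^'n"
  assume "A \<in> carrier GL" "B \<in> carrier GL"
  then show "A \<otimes>\<^bsub>GL\<^esub> B \<in> carrier GL"
    by (simp add: GL_def invertible_mult)
next
  fix A :: "'a^'n^'n"
  assume "A \<in> carrier GL"
  then obtain B where "A ** B = mat 1" "B ** A = mat 1"
    unfolding GL_def invertible_def by auto
  then show "\<exists>B\<in>carrier GL. B \<otimes>\<^bsub>GL\<^esub> A = \<one>\<^bsub>GL\<^esub>"
    unfolding GL_def by (intro bexI[of _ B]) (auto simp: invertible_def)
next
  fix A B C :: "'a^'n^'n"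
  show "A \<otimes>\<^bsub>GL\<^esub> B \<otimes>\<^bsub>GL\<^esub> C = A \<otimes>\<^bsub>GL\<^esub> (B \<otimes>\<^bsub>GL\<^esub> C)"
    by (simp add: GL_def matrix_mul_assoc)
qed (simp add: GL_def)

(* The ideal of V is generated by polynomials with coefficients in k; module.span times S is the
   ideal generated by S.  For V contained in GL_n this may be tested in K[x_ij] instead of
   K[GL_n] = K[x_ij, 1/det], as the ideals of V there are the localization and the contraction
   of each other. *)
definition defined_over :: "'a set \<Rightarrow> ('a::field^'n^'n) set \<Rightarrow> bool" where
  "defined_over k V \<longleftrightarrow>
     vanishing_ideal V = module.span times (vanishing_ideal V \<inter> polys_over k)"

definition linear_algebraic_group :: "'a set \<Rightarrow> ('a::field^'n^'n) set \<Rightarrow> bool" where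
  "linear_algebraic_group k G \<longleftrightarrow>
     subgroup G GL \<and> closedin (subtopology zariski (carrier GL)) G \<and> defined_over k G"

definition k_points :: "'a set \<Rightarrow> ('a^'n^'n) set \<Rightarrow> ('a::field^'n^'n) set" where
  "k_points k G = {A \<in> G. \<forall>i j. A $ i $ j \<in> k}"

definition zariski_dense :: "('a::field^'n^'n) set \<Rightarrow> ('a^'n^'n) set \<Rightarrow> bool" where
  "zariski_dense \<Gamma> G \<longleftrightarrow> \<Gamma> \<subseteq> G \<and> subtopology zariski G closure_of \<Gamma> = G"

definition alg_presentable_by_product :: "'a set \<Rightarrow> ('a::field^'n^'n) set \<Rightarrow> bool" where
  "alg_presentable_by_product k G \<longleftrightarrow> (\<exists>G1 G2.
     linear_algebraic_group k G1 \<and> G1 \<subseteq> G \<and> connectedin zariski G1 \<and> zariski_dim G1 > 0 \<and>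
     linear_algebraic_group k G2 \<and> G2 \<subseteq> G \<and> connectedin zariski G2 \<and> zariski_dim G2 > 0 \<and>
     (\<forall>a\<in>G1. \<forall>b\<in>G2. a ** b = b ** a) \<and>
     (\<lambda>(a, b). a ** b) ` (G1 \<times> G2) = G)"


section \<open>Abstract groups\<close>

(* HOL cannot quantify over types inside a formula, so the types of the elements of the two
   factors are parameters.  "Not presentable by a product" is the negation for all types 'b
   and 'c. *)
definition presentable_by_product ::
    "'b itself \<Rightarrow> 'c itself \<Rightarrow> 'g monoid \<Rightarrow> bool" where
  "presentable_by_product TB TC \<Gamma> \<longleftrightarrow> infinite (carrier \<Gamma>) \<and>
     (\<exists>(\<Gamma>1 :: 'b monoid) (\<Gamma>2 :: 'c monoid) \<phi>.
        group \<Gamma>1 \<and> group \<Gamma>2 \<and> \<phi> \<in> hom (\<Gamma>1 \<times>\<times> \<Gamma>2) \<Gamma> \<and>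
        infinite (\<phi> ` (carrier \<Gamma>1 \<times> {\<one>\<^bsub>\<Gamma>2\<^esub>})) \<and>
        infinite (\<phi> ` ({\<one>\<^bsub>\<Gamma>1\<^esub>} \<times> carrier \<Gamma>2)) \<and>
        finite (rcosets\<^bsub>\<Gamma>\<^esub> (\<phi> ` carrier (\<Gamma>1 \<times>\<times> \<Gamma>2))))"

end

(* Let A and B be the images in \<Gamma> of the two factors of a presentation of \<Gamma> by a product. By
   noetherianity A and B have subgroups A' and B' of finite index with irreducible Zariski
   closures. The closures G1 and G2 of A' and B' in GL commute, are connected and infinite, and
   are defined over k because A' and B' consist of k-points. Finitely many cosets of A'B' cover
   the dense subgroup \<Gamma>, so A'B' is dense in the connected group G.

   It remains to see that G1 G2 is closed. Instead of Chevalley's theorem on constructible sets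
   this uses an extension theorem for points: eliminating the coordinates of a and b from the set of
   triples (a, b, ab) one at a time yields a regular function r, not identically zero on A'B',
   such that every g in the closure of A'B' with r(g) \<noteq> 0 lies in G1 G2. Any element of the
   closure can be moved into this locus by a factor from A'B'. *)

theory Submission
  imports Defs "HOL-Library.Function_Algebras"
begin

no_notation Formal_Power_Series.fps.fps_nth (infixl \<open>$\<close> 75)

hide_const (open) UnivPoly.up_ring.coeff UnivPoly.up_ring.monom Polynomials.degree
  Polynomials.lead_coeff Module.module.smult

section \<open>Polynomials over a subring\<close>

text \<open>No coordinate ring is formed as a quotient. It is replaced by the ring of polynomial
  functions together with vanishing on a set \<open>Z\<close>; when \<open>Z\<close> is irreducible,
  this vanishing behaves like equality to 0 in a domain. Polynomials over such a ring have
  coefficients with zero divisors, so division needs powers of the leading coefficient, and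
  "nonzero" has to be read as "not trivial on \<open>Z\<close>". Closures \<open>zcl\<close> are
  taken among all matrices, where polynomials suffice as functions, and are then cut down to
  \<open>GL\<close>. Two facts therefore need separate arguments: the closure of a group contains
  the inverses of its invertible elements, and the factors recovered by elimination are invertible.
  The first comes from the descending chain condition, the second from carrying the function det a
  det b through the elimination. Irreducibility of A' and B' is used repeatedly: it makes their
  closures connected, it gives a dimension count from a point and the whole set, and it makes the
  vanishing ideal of the set of triples prime. Algebraic closedness of K supplies a value for a
  coordinate that is algebraic over the others.\<close>

locale subring_set =
  fixes R :: "'s::comm_ring_1 set"
  assumes one_mem: "1 \<in> R"
    and diff_mem: "a \<in> R \<Longrightarrow> b \<in> R \<Longrightarrow> a - b \<in> R"
    and mult_mem: "a \<in> R \<Longrightarrow> b \<in> R \<Longrightarrow> a * b \<in> R"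
begin

lemma zero_mem: "0 \<in> R"
  using diff_mem[OF one_mem one_mem] by simp

lemma uminus_mem: "a \<in> R \<Longrightarrow> - a \<in> R"
  using diff_mem[OF zero_mem] by fastforce

lemma add_mem: "a \<in> R \<Longrightarrow> b \<in> R \<Longrightarrow> a + b \<in> R"
  using diff_mem[of a "- b"] uminus_mem by simp

lemma sum_mem: "(\<And>i. i \<in> I \<Longrightarrow> f i \<in> R) \<Longrightarrow> sum f I \<in> R"
  by (induction I rule: infinite_finite_induct) (auto intro: zero_mem add_mem)

lemma prod_mem: "(\<And>i. i \<in> I \<Longrightarrow> f i \<in> R) \<Longrightarrow> prod f I \<in> R"
  by (induction I rule: infinite_finite_induct) (auto intro: one_mem mult_mem)

lemma power_mem: "a \<in> R \<Longrightarrow> a ^ n \<in> R"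
  by (induction n) (auto intro: one_mem mult_mem)

end

definition polys_in :: "'s::comm_ring_1 set \<Rightarrow> 's poly set" where
  "polys_in R = {p. \<forall>i. coeff p i \<in> R}"

definition adjoin :: "'s::comm_ring_1 set \<Rightarrow> 's \<Rightarrow> 's set" where
  "adjoin R t = (\<lambda>p. poly p t) ` polys_in R"

context subring_set
begin

lemma monom_mem: "c \<in> R \<Longrightarrow> monom c n \<in> polys_in R"
  by (auto simp: polys_in_def zero_mem)

lemma const_mem: "c \<in> R \<Longrightarrow> [:c:] \<in> polys_in R"
  using monom_mem[of c 0] by (simp add: monom_0)

lemma subring_set_polys_in: "subring_set (polys_in R)"
proof
  show "1 \<in> polys_in R" using const_mem[OF one_mem] by (simp add: one_pCons)
next
  fix p q assume "p \<in> polys_in R" "q \<in> polys_in R"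
  then show "p - q \<in> polys_in R" "p * q \<in> polys_in R"
    by (auto simp: polys_in_def coeff_mult intro!: diff_mem sum_mem mult_mem)
qed

interpretation polys: subring_set "polys_in R"
  by (rule subring_set_polys_in)

lemma subring_set_adjoin: "subring_set (adjoin R t)"
proof
  show "1 \<in> adjoin R t"
    unfolding adjoin_def by (rule image_eqI[OF _ polys.one_mem]) simp
next
  fix a b assume "a \<in> adjoin R t" "b \<in> adjoin R t"
  then obtain p q where "p \<in> polys_in R" "q \<in> polys_in R" "a = poly p t" "b = poly q t"
    by (auto simp: adjoin_def)
  then show "a - b \<in> adjoin R t" "a * b \<in> adjoin R t"
    unfolding adjoin_def
    by (auto intro: image_eqI[of _ _ "p - q"] image_eqI[of _ _ "p * q"] polys.diff_mem polys.mult_mem)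
qed

lemma adjoin_superset: "insert t R \<subseteq> adjoin R t"
proof -
  have "poly (monom 1 1) t \<in> adjoin R t"
    unfolding adjoin_def by (intro imageI monom_mem one_mem)
  moreover have "c \<in> adjoin R t" if "c \<in> R" for c
    using imageI[OF const_mem[OF that], of "\<lambda>p. poly p t"] by (simp add: adjoin_def)
  ultimately show ?thesis by (auto simp: poly_monom)
qed

text \<open>Leading coefficients will be functions, so long division works only after multiplying by
  a power of one. Degrees of products may drop because of zero divisors, hence estimates in place of
  equalities. The bound on \<open>degree u\<close> later makes a cofactor of the minimal relation
  smaller than that relation.\<close>

lemma pseudo_division:
  assumes "f \<in> polys_in R" "g \<in> polys_in R"
  shows "\<exists>N u w. u \<in> polys_in R \<and> w \<in> polys_in R \<and> smult (lead_coeff f ^ N) g = u * f + w \<and>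
    (w = 0 \<or> degree w < degree f) \<and> degree u \<le> degree g - degree f"
  using assms(2)
proof (induction "degree g" arbitrary: g rule: less_induct)
  case less
  let ?d = "degree f" and ?a = "lead_coeff f"
  show ?case
  proof (cases "g = 0 \<or> degree g < ?d")
    case True
    then show ?thesis using less.prems
      by (intro exI[of _ 0] exI[of _ g]) (auto intro: polys.zero_mem)
  next
    case False
    let ?m = "monom (lead_coeff g) (degree g - ?d)"
    have a: "?a \<in> R" and b: "lead_coeff g \<in> R"
      using assms(1) less.prems by (auto simp: polys_in_def)
    have m: "?m \<in> polys_in R" by (rule monom_mem[OF b])
    define h where "h = smult ?a g - ?m * f"
    have "smult ?a g \<in> polys_in R"
      using polys.mult_mem[OF const_mem[OF a] less.prems] by simp
    then have h: "h \<in> polys_in R"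
      unfolding h_def by (intro polys.diff_mem polys.mult_mem m assms)
    have dm: "degree ?m = degree g - ?d"
      using False by (simp add: degree_monom_eq)
    have "degree (?m * f) \<le> degree g"
      using degree_mult_le[of ?m f] dm False by simp
    then have dh: "degree h \<le> degree g"
      unfolding h_def by (intro degree_diff_le degree_smult_le)
    have c: "coeff h (degree g) = 0"
      using False coeff_mult_degree_sum[of ?m f] dm by (simp add: h_def mult.commute)
    show ?thesis
    \<comment> \<open>The degree cannot drop strictly from 0; in that case \<open>h\<close> is
      already 0.\<close>
    proof (cases "degree g = 0")
      case True
      then have "h = 0" using dh c
        by (metis le_zero_eq leading_coeff_0_iff)
      then have "smult (?a ^ 1) g = ?m * f + 0" by (simp add: h_def)
      then show ?thesis using m dm polys.zero_mem
        by (metis order_refl)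
    next
      case dg: False
      have "degree h < degree g"
      proof (rule ccontr)
        assume "\<not> degree h < degree g"
        then have "degree h = degree g" using dh by simp
        then have "h = 0" using c by (metis leading_coeff_0_iff)
        then show False using \<open>\<not> degree h < degree g\<close> dg by simp
      qed
      from less.hyps[OF this h] obtain N u w where
        uw: "u \<in> polys_in R" "w \<in> polys_in R" "smult (?a ^ N) h = u * f + w"
          "w = 0 \<or> degree w < ?d" "degree u \<le> degree h - ?d" by blast
      let ?u = "u + smult (?a ^ N) ?m"
      have "smult (?a ^ N) ?m \<in> polys_in R"
        using polys.mult_mem[OF const_mem[OF power_mem[OF a]] m] by simp
      then have "?u \<in> polys_in R" by (rule polys.add_mem[OF uw(1)])
      moreover have "smult (?a ^ Suc N) g = ?u * f + w"
      proof -
        have "smult (?a ^ Suc N) g = smult (?a ^ N) (h + ?m * f)"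
          by (simp add: h_def mult.commute)
        then show ?thesis using uw(3) by (simp add: smult_add_right algebra_simps)
      qed
      moreover have "degree ?u \<le> degree g - ?d"
        using uw(5) dh dm by (intro degree_add_le) (auto intro: order_trans[OF degree_smult_le])
      ultimately show ?thesis using uw(2,4) by metis
    qed
  qed
qed

end

section \<open>Hilbert's basis theorem\<close>

inductive_set lin_span :: "'s::comm_ring_1 set \<Rightarrow> 's set \<Rightarrow> 's set" for R M where
  zero: "0 \<in> lin_span R M"
| add: "x \<in> lin_span R M \<Longrightarrow> r \<in> R \<Longrightarrow> m \<in> M \<Longrightarrow> x + r * m \<in> lin_span R M"

lemma lin_span_mono: "x \<in> lin_span R M \<Longrightarrow> M \<subseteq> M' \<Longrightarrow> x \<in> lin_span R M'"
  by (induction rule: lin_span.induct) (auto intro: lin_span.intros)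

lemma lin_span_add: "y \<in> lin_span R M \<Longrightarrow> x \<in> lin_span R M \<Longrightarrow> x + y \<in> lin_span R M"
  by (induction rule: lin_span.induct) (auto simp: add.assoc[symmetric] intro: lin_span.intros)

lemma (in subring_set) lin_span_mult:
  "x \<in> lin_span R M \<Longrightarrow> r \<in> R \<Longrightarrow> r * x \<in> lin_span R M"
  by (induction rule: lin_span.induct)
    (auto simp: distrib_left mult.assoc[symmetric] intro: lin_span.intros mult_mem)

lemma (in subring_set) lin_span_base:
  "m \<in> M \<Longrightarrow> m \<in> lin_span R M"
  using lin_span.add[OF lin_span.zero one_mem] by simp

lemma (in subring_set) lin_span_diff:
  "x \<in> lin_span R M \<Longrightarrow> y \<in> lin_span R M \<Longrightarrow> x - y \<in> lin_span R M"
  using lin_span_add[of "- y" R M x] lin_span_mult[of y M "-1"] uminus_mem[OF one_mem] by simp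

lemma (in subring_set) lin_span_subset:
  "x \<in> lin_span R M \<Longrightarrow> M \<subseteq> lin_span R M' \<Longrightarrow> x \<in> lin_span R M'"
  by (induction rule: lin_span.induct) (auto intro: lin_span.zero lin_span_add lin_span_mult)

text \<open>The ascending chain condition expressed by sequences of generators, without ideals as
  objects. The span of the empty set is \<open>{0}\<close>, so \<open>n = 0\<close> means
  \<open>f 0 = 0\<close>.\<close>

definition noetherian_set :: "'s::comm_ring_1 set \<Rightarrow> bool" where
  "noetherian_set R \<longleftrightarrow>
    (\<forall>f::nat \<Rightarrow> 's. range f \<subseteq> R \<longrightarrow> (\<exists>n. f n \<in> lin_span R (f ` {..<n})))"

text \<open>Suppose no term of the sequence \<open>f\<close> lies in the span of its predecessors. Choosing
  successively polynomials \<open>P n\<close> of least degree whose values lie in the ideal generated by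
  \<open>f\<close> but not in the span of the values of the previous ones, the leading coefficients of the
  \<open>P n\<close> violate the hypothesis on \<open>R\<close>.\<close>

theorem (in subring_set) noetherian_adjoin:
  assumes "noetherian_set R"
  shows "noetherian_set (adjoin R t)"
  unfolding noetherian_set_def
proof (intro allI impI, rule ccontr)
  interpret A: subring_set "adjoin R t" by (rule subring_set_adjoin)
  interpret polys: subring_set "polys_in R" by (rule subring_set_polys_in)
  let ?A = "adjoin R t"
  fix f :: "nat \<Rightarrow> 's"
  assume fA: "range f \<subseteq> ?A" and "\<nexists>n. f n \<in> lin_span ?A (f ` {..<n})"
  then have fn: "f n \<notin> lin_span ?A (f ` {..<n})" for n by blast
  define I where "I = lin_span ?A (range f)"
  \<comment> \<open>Each element of the ideal involves only finitely many terms of \<open>f\<close>.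
    With \<open>fn\<close> this shows that finitely many choices \<open>P i\<close> never exhaust
    the ideal.\<close>
  have fin: "\<exists>n. F \<subseteq> lin_span ?A (f ` {..<n})" if "finite F" "F \<subseteq> I" for F
    using that
  proof (induction F rule: finite_induct)
    case (insert x F)
    then obtain n where n: "F \<subseteq> lin_span ?A (f ` {..<n})" by blast
    have "x \<in> I" using insert.prems by simp
    then have "\<exists>m. x \<in> lin_span ?A (f ` {..<m})"
      unfolding I_def
    proof (induction rule: lin_span.induct)
      case (add x r b)
      then obtain m i where mi: "x \<in> lin_span ?A (f ` {..<m})" "b = f i" by blast
      have "x \<in> lin_span ?A (f ` {..<max m (Suc i)})"
        by (rule lin_span_mono[OF mi(1)]) auto
      then have "x + r * b \<in> lin_span ?A (f ` {..<max m (Suc i)})"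
        by (rule lin_span.add) (use add mi in auto)
      then show ?case by blast
    qed (auto intro: lin_span.zero)
    then obtain m where m: "x \<in> lin_span ?A (f ` {..<m})" by blast
    have "f ` {..<m} \<subseteq> f ` {..<max m n}" "f ` {..<n} \<subseteq> f ` {..<max m n}"
      by (intro image_mono; simp)+
    then have "insert x F \<subseteq> lin_span ?A (f ` {..<max m n})"
      using lin_span_mono[OF m] lin_span_mono[of _ ?A "f ` {..<n}"] n by (meson insert_subset subset_iff)
    then show ?case by blast
  qed auto
  \<comment> \<open>An element of \<open>adjoin R t\<close> has many representing polynomials, so
    minimality of degree is imposed on representatives: \<open>Q F\<close> describes the candidates
    once \<open>F\<close> has been chosen, \<open>S F\<close> those of least degree.\<close>
  define Q where "Q F p \<longleftrightarrow> p \<in> polys_in R \<and> poly p t \<in> I \<and> poly p t \<notin> lin_span ?A ((\<lambda>p. poly p t) ` F)"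
    for F p
  define S where "S F p \<longleftrightarrow> Q F p \<and> (\<forall>q. Q F q \<longrightarrow> degree p \<le> degree q)" for F p
  have "\<exists>P. \<forall>n::nat. S (P ` {..<n}) (P n)"
  proof (rule dependent_wf_choice[of less_than "\<lambda>P (n::nat). S (P ` {..<n})"])
    show "wf less_than" by simp
    show "S (g ` {..<n}) r = S (h ` {..<n}) r" if "\<And>z. (z, n) \<in> less_than \<Longrightarrow> g z = h z"
      for g h :: "nat \<Rightarrow> 's poly" and n r
    proof -
      have "g ` {..<n} = h ` {..<n}" using that by (intro image_cong) auto
      then show ?thesis by simp
    qed
    fix n and P :: "nat \<Rightarrow> 's poly"
    assume P: "\<And>y. (y, n) \<in> less_than \<Longrightarrow> S (P ` {..<y}) (P y)"
    let ?F = "(\<lambda>p. poly p t) ` P ` {..<n}"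
    have "?F \<subseteq> I" using P by (auto simp: S_def Q_def)
    with fin[of ?F] obtain m where m: "?F \<subseteq> lin_span ?A (f ` {..<m})" by auto
    have "f m \<notin> lin_span ?A ?F" using fn[of m] A.lin_span_subset[OF _ m] by blast
    moreover obtain p where "p \<in> polys_in R" "poly p t = f m"
      using fA unfolding adjoin_def by (metis imageE range_subsetD)
    moreover have "f m \<in> I" unfolding I_def by (rule A.lin_span_base) simp
    ultimately have "Q (P ` {..<n}) p" by (simp add: Q_def)
    then show "\<exists>r. S (P ` {..<n}) r"
      unfolding S_def using ex_has_least_nat[of "Q (P ` {..<n})" p degree] by blast
  qed
  then obtain P where "\<forall>n::nat. S (P ` {..<n}) (P n)" ..
  then have P: "S (P ` {..<n}) (P n)" for n by (rule spec)
  have PR: "P n \<in> polys_in R" and PI: "poly (P n) t \<in> I"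
    and PL: "poly (P n) t \<notin> lin_span ?A ((\<lambda>p. poly p t) ` P ` {..<n})"
    and Pmin: "Q (P ` {..<n}) q \<Longrightarrow> degree (P n) \<le> degree q" for n q
    using P[of n] by (auto simp: S_def Q_def)
  \<comment> \<open>A candidate after more choices is also one after fewer, so the least degrees
    never decrease. This makes the exponent \<open>?k\<close> below a true difference.\<close>
  have mono: "degree (P i) \<le> degree (P n)" if "i \<le> n" for i n
  proof (rule Pmin)
    have "poly (P n) t \<notin> lin_span ?A ((\<lambda>p. poly p t) ` P ` {..<i})"
    proof
      assume "poly (P n) t \<in> lin_span ?A ((\<lambda>p. poly p t) ` P ` {..<i})"
      moreover have "(\<lambda>p. poly p t) ` P ` {..<i} \<subseteq> (\<lambda>p. poly p t) ` P ` {..<n}"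
        using that by (intro image_mono) simp
      ultimately show False using PL[of n] lin_span_mono by blast
    qed
    then show "Q (P ` {..<i}) (P n)" using PR PI by (simp add: Q_def)
  qed
  have "range (\<lambda>n. lead_coeff (P n)) \<subseteq> R" using PR by (auto simp: polys_in_def)
  with assms obtain n where
    n: "lead_coeff (P n) \<in> lin_span R ((\<lambda>n. lead_coeff (P n)) ` {..<n})"
    unfolding noetherian_set_def by blast
  let ?d = "degree (P n)"
  \<comment> \<open>The relation between leading coefficients lifts to polynomials: multiplying each
    \<open>P i\<close> by a monomial moves its leading term to degree \<open>?d\<close>.\<close>
  have "\<exists>h \<in> lin_span (polys_in R) (P ` {..<n}). coeff h ?d = c \<and> degree h \<le> ?d"
    if "c \<in> lin_span R ((\<lambda>n. lead_coeff (P n)) ` {..<n})" for c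
    using that
  proof (induction rule: lin_span.induct)
    case zero
    then show ?case by (intro bexI[of _ 0]) (auto intro: lin_span.zero)
  next
    case (add x r m)
    then obtain h i where h: "h \<in> lin_span (polys_in R) (P ` {..<n})" "coeff h ?d = x" "degree h \<le> ?d"
      and i: "i < n" "m = lead_coeff (P i)" by auto
    let ?k = "?d - degree (P i)"
    have le: "degree (P i) \<le> ?d" using mono i by simp
    have "degree (monom r ?k * P i) \<le> ?k + degree (P i)"
      by (rule order_trans[OF degree_mult_le]) (simp add: degree_monom_le)
    moreover have "coeff (monom r ?k * P i) ?d = r * m"
      using i(2) le by (simp add: coeff_monom_mult)
    ultimately show ?case using h le lin_span.add[OF h(1) monom_mem[OF add.hyps(2)], of "P i" ?k] i
      by (intro bexI[of _ "h + monom r ?k * P i"]) (auto intro!: degree_add_le)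
  qed
  with n obtain h where h: "h \<in> lin_span (polys_in R) (P ` {..<n})"
      "coeff h ?d = lead_coeff (P n)" "degree h \<le> ?d" by blast
  have hR: "h \<in> polys_in R" using h(1)
    by (induction rule: lin_span.induct) (use PR in \<open>auto intro: polys.zero_mem polys.add_mem polys.mult_mem\<close>)
  have ht: "poly h t \<in> lin_span ?A ((\<lambda>p. poly p t) ` P ` {..<n})" using h(1)
    by (induction rule: lin_span.induct) (auto simp: adjoin_def intro!: lin_span.intros)
  have hI: "poly h t \<in> I"
    unfolding I_def by (rule A.lin_span_subset[OF ht]) (use PI in \<open>auto simp: I_def\<close>)
  \<comment> \<open>Still a candidate, since \<open>h\<close> evaluates into the span of the earlier
    values, but the coefficient at \<open>?d\<close> cancels. Minimality then forces it to be 0,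
    whose value does lie in that span.\<close>
  let ?q = "P n - h"
  have "poly ?q t \<notin> lin_span ?A ((\<lambda>p. poly p t) ` P ` {..<n})"
    using lin_span_add[OF ht, of "poly ?q t"] PL[of n] by auto
  moreover have "poly ?q t \<in> I" using PI[of n] hI unfolding I_def by (simp add: A.lin_span_diff)
  ultimately have Q: "Q (P ` {..<n}) ?q" using PR hR by (simp add: Q_def polys.diff_mem)
  then have "?d \<le> degree ?q" by (rule Pmin)
  moreover have "degree ?q \<le> ?d" using h(3) by (simp add: degree_diff_le)
  ultimately have "degree ?q = ?d" by (rule antisym[rotated])
  then have "lead_coeff ?q = 0" using h(2) by simp
  then have "?q = 0" by (simp only: leading_coeff_0_iff)
  then show False using \<open>poly ?q t \<notin> _\<close> by (simp add: lin_span.zero)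
qed

section \<open>Algebras of functions\<close>

lemma sum_fun_apply: "(sum f I :: 'x \<Rightarrow> 'a::comm_monoid_add) x = (\<Sum>i\<in>I. f i x)"
  by (induction I rule: infinite_finite_induct) auto

lemma prod_fun_apply: "(prod f I :: 'x \<Rightarrow> 'a::comm_monoid_mult) x = (\<Prod>i\<in>I. f i x)"
  by (induction I rule: infinite_finite_induct) auto

lemma power_fun_apply: "((f :: 'x \<Rightarrow> 'a::comm_ring_1) ^ n) x = f x ^ n"
  by (induction n) auto

lemma poly_fun_apply:
  "poly p t x = poly (map_poly (\<lambda>c. c x) p) (t x :: 'a::comm_ring_1)"
  by (induction p) (auto simp: map_poly_pCons)

inductive_set fun_alg :: "('x \<Rightarrow> 'a::comm_ring_1) set \<Rightarrow> ('x \<Rightarrow> 'a) set" for F where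
  const: "(\<lambda>_. c) \<in> fun_alg F"
| gen: "f \<in> F \<Longrightarrow> f \<in> fun_alg F"
| add: "f \<in> fun_alg F \<Longrightarrow> g \<in> fun_alg F \<Longrightarrow> f + g \<in> fun_alg F"
| mult: "f \<in> fun_alg F \<Longrightarrow> g \<in> fun_alg F \<Longrightarrow> f * g \<in> fun_alg F"

interpretation fun_alg: subring_set "fun_alg F" for F
proof
  show "1 \<in> fun_alg F" unfolding one_fun_def by (rule fun_alg.const)
next
  fix f g assume "f \<in> fun_alg F" "g \<in> fun_alg F"
  then have "f + (\<lambda>_. - 1) * g \<in> fun_alg F" by (intro fun_alg.add fun_alg.mult fun_alg.const)
  moreover have "f + (\<lambda>_. - 1) * g = f - g" by (rule ext) simp
  ultimately show "f - g \<in> fun_alg F" by simp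
qed (rule fun_alg.mult)

lemma fun_alg_comp:
  assumes "f \<in> fun_alg F" "\<And>g. g \<in> F \<Longrightarrow> (\<lambda>y. g (h y)) \<in> fun_alg F'"
  shows "(\<lambda>y. f (h y)) \<in> fun_alg F'"
  using assms(1)
proof (induction rule: fun_alg.induct)
  case (add f g)
  then show ?case using fun_alg.add[OF add.IH] by (simp add: plus_fun_def)
next
  case (mult f g)
  then show ?case using fun_alg.mult[OF mult.IH] by (simp add: times_fun_def)
qed (use assms(2) in \<open>auto intro: fun_alg.const\<close>)

lemma fun_alg_mono: "F \<subseteq> F' \<Longrightarrow> fun_alg F \<subseteq> fun_alg F'"
  using fun_alg_comp[of _ F "\<lambda>x. x" F'] by (auto intro: fun_alg.gen)

lemma fun_alg_insert: "fun_alg (insert t F) = adjoin (fun_alg F) t"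
proof
  interpret A: subring_set "adjoin (fun_alg F) t" by (rule fun_alg.subring_set_adjoin)
  have sup: "insert t (fun_alg F) \<subseteq> adjoin (fun_alg F) t"
    by (rule fun_alg.adjoin_superset)
  show "fun_alg (insert t F) \<subseteq> adjoin (fun_alg F) t"
  proof
    fix f assume "f \<in> fun_alg (insert t F)"
    then show "f \<in> adjoin (fun_alg F) t"
    proof (induction rule: fun_alg.induct)
      case (add f g)
      show ?case by (rule A.add_mem[OF add.IH])
    next
      case (mult f g)
      show ?case by (rule A.mult_mem[OF mult.IH])
    qed (use sup in \<open>auto intro: fun_alg.const fun_alg.gen\<close>)
  qed
  show "adjoin (fun_alg F) t \<subseteq> fun_alg (insert t F)"
  proof -
    have "t \<in> fun_alg (insert t F)" "fun_alg F \<subseteq> fun_alg (insert t F)"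
      by (auto intro: fun_alg.gen) (meson fun_alg_mono subsetD subset_insertI)
    then have "(\<Sum>i\<le>degree p. coeff p i * t ^ i) \<in> fun_alg (insert t F)"
      if "p \<in> polys_in (fun_alg F)" for p
      using that by (intro fun_alg.sum_mem fun_alg.mult fun_alg.power_mem) (auto simp: polys_in_def)
    then show ?thesis by (auto simp: adjoin_def poly_altdef)
  qed
qed

text \<open>Generators are adjoined one at a time. The start is the field of constants, where
  \<open>f 1\<close> is a multiple of \<open>f 0\<close> unless \<open>f 0\<close> is 0.\<close>

lemma noetherian_fun_alg:
  fixes F :: "('x \<Rightarrow> 'a::field) set"
  assumes "finite F"
  shows "noetherian_set (fun_alg F)"
  using assms
proof (induction F rule: finite_induct)
  case empty
  show ?case unfolding noetherian_set_def
  proof (intro allI impI)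
    fix f :: "nat \<Rightarrow> 'x \<Rightarrow> 'a"
    assume f: "range f \<subseteq> fun_alg {}"
    have "\<exists>c. g = (\<lambda>_. c)" if "g \<in> fun_alg {}" for g :: "'x \<Rightarrow> 'a"
      using that by (induction rule: fun_alg.induct) (auto simp: plus_fun_def times_fun_def)
    with f have "\<forall>i. \<exists>c. f i = (\<lambda>_. c)" by blast
    then obtain c where c: "\<And>i. f i = (\<lambda>_. c i)" by metis
    show "\<exists>n. f n \<in> lin_span (fun_alg {}) (f ` {..<n})"
    proof (cases "c 0 = 0")
      case True
      then have "f 0 = 0" by (simp add: c zero_fun_def)
      then show ?thesis by (metis lin_span.zero)
    next
      case False
      have "0 + (\<lambda>_. c 1 / c 0) * f 0 \<in> lin_span (fun_alg {}) (f ` {..<1})"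
        by (intro lin_span.add lin_span.zero fun_alg.const) simp
      moreover have "0 + (\<lambda>_. c 1 / c 0) * f 0 = f 1"
        using False by (auto simp: c)
      ultimately show ?thesis by metis
    qed
  qed
next
  case (insert t F)
  then show ?case by (simp add: fun_alg_insert fun_alg.noetherian_adjoin)
qed

section \<open>Extension of points\<close>

definition coord_alg :: "'v set \<Rightarrow> (('v \<Rightarrow> 'a::comm_ring_1) \<Rightarrow> 'a) set" where
  "coord_alg U = fun_alg ((\<lambda>v x. x v) ` U)"

lemma coord_alg_insert: "coord_alg (insert v U) = adjoin (coord_alg U) (\<lambda>x. x v)"
  by (simp add: coord_alg_def fun_alg_insert)

lemma coord_alg_mono: "U \<subseteq> W \<Longrightarrow> coord_alg U \<subseteq> coord_alg W"
  unfolding coord_alg_def by (intro fun_alg_mono image_mono)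

lemma coord_alg_cong:
  assumes "f \<in> coord_alg U" "\<And>v. v \<in> U \<Longrightarrow> x v = y v"
  shows "f x = f y"
  using assms(1) unfolding coord_alg_def
  by (induction rule: fun_alg.induct) (use assms(2) in auto)

definition vanishes_on :: "'x set \<Rightarrow> ('x \<Rightarrow> 'a::zero) \<Rightarrow> bool" where
  "vanishes_on Z f \<longleftrightarrow> (\<forall>x\<in>Z. f x = 0)"

text \<open>\<open>closure_point Z U y\<close> says that the coordinates of \<open>y\<close> in \<open>U\<close> form a point of the Zariski closure of
  the projection of \<open>Z\<close> to these coordinates.\<close>

definition closure_point :: "('v \<Rightarrow> 'a::comm_ring_1) set \<Rightarrow> 'v set \<Rightarrow> ('v \<Rightarrow> 'a) \<Rightarrow> bool" where
  "closure_point Z U y \<longleftrightarrow> (\<forall>f\<in>coord_alg U. vanishes_on Z f \<longrightarrow> f y = 0)"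

text \<open>The vanishing ideal of \<open>Z\<close> behaves as a prime ideal; functions not
  vanishing on \<open>Z\<close> then act as nonzero elements of the coordinate ring of its
  closure.\<close>

locale integral_set =
  fixes Z :: "('v \<Rightarrow> 'a::{alg_closed_field, field_char_0}) set"
  assumes integral: "f \<in> coord_alg UNIV \<Longrightarrow> g \<in> coord_alg UNIV \<Longrightarrow> vanishes_on Z (f * g) \<Longrightarrow>
    vanishes_on Z f \<or> vanishes_on Z g"
begin

lemma not_vanishes_power:
  "f \<in> coord_alg UNIV \<Longrightarrow> \<not> vanishes_on Z f \<Longrightarrow> \<not> vanishes_on Z (f ^ n)"
  by (auto simp: vanishes_on_def power_fun_apply)

text \<open>Such a \<open>p\<close> is the zero polynomial over the coordinate ring of the closure
  of \<open>Z\<close>, although its formal degree may be large.\<close>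

definition trivial_poly :: "(('v \<Rightarrow> 'a) \<Rightarrow> 'a) poly \<Rightarrow> bool" where
  "trivial_poly p \<longleftrightarrow> (\<forall>i. vanishes_on Z (coeff p i))"

lemma trivial_poly_0: "trivial_poly 0"
  by (simp add: trivial_poly_def vanishes_on_def)

lemma vanishes_on_trivial_poly: "trivial_poly p \<Longrightarrow> vanishes_on Z (poly p t)"
  by (auto simp: trivial_poly_def vanishes_on_def poly_altdef sum_fun_apply)

lemma trivial_poly_mult: "trivial_poly p \<Longrightarrow> trivial_poly (p * q)"
  by (auto simp: trivial_poly_def vanishes_on_def coeff_mult sum_fun_apply)

text \<open>Take a nontrivial member of least degree. If its leading coefficient vanished on
  \<open>Z\<close>, removing the leading term would subtract a trivial polynomial, leaving a
  nontrivial member of smaller degree.\<close>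

lemma ex_minimal_poly:
  assumes "Q p0" "\<not> trivial_poly p0"
    and Q: "\<And>p. Q p \<Longrightarrow> p \<in> polys_in (coord_alg U)"
    and diff: "\<And>p m. Q p \<Longrightarrow> m \<in> polys_in (coord_alg U) \<Longrightarrow> trivial_poly m \<Longrightarrow> Q (p - m)"
  shows "\<exists>p. Q p \<and> \<not> vanishes_on Z (lead_coeff p) \<and> (\<forall>q. Q q \<longrightarrow> degree q < degree p \<longrightarrow> trivial_poly q)"
proof -
  interpret R: subring_set "coord_alg U"
    unfolding coord_alg_def by (rule fun_alg.subring_set_axioms)
  obtain p where p: "Q p" "\<not> trivial_poly p"
    and min: "\<And>q. Q q \<Longrightarrow> degree q < degree p \<Longrightarrow> trivial_poly q"
    using ex_has_least_nat[of "\<lambda>p. Q p \<and> \<not> trivial_poly p" p0 degree] assms(1,2)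
    by (metis not_less)
  have "\<not> vanishes_on Z (lead_coeff p)"
  proof
    assume lc: "vanishes_on Z (lead_coeff p)"
    let ?m = "monom (lead_coeff p) (degree p)"
    let ?q = "p - ?m"
    have triv: "trivial_poly ?m"
      using lc by (auto simp: trivial_poly_def vanishes_on_def)
    have "?m \<in> polys_in (coord_alg U)"
      using Q[OF p(1)] by (intro R.monom_mem) (auto simp: polys_in_def)
    then have "Q ?q" using diff p(1) triv by blast
    have "\<not> trivial_poly ?q"
      using p(2) triv by (auto simp: trivial_poly_def vanishes_on_def)
    then have "\<not> degree ?q < degree p" using min \<open>Q ?q\<close> by blast
    moreover have "degree ?q \<le> degree p"
      by (intro degree_diff_le degree_monom_le order_refl)
    ultimately have "degree ?q = degree p" by simp
    then have "lead_coeff ?q = 0" by simp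
    then have "?q = 0" by (simp only: leading_coeff_0_iff)
    then show False using \<open>\<not> trivial_poly ?q\<close> trivial_poly_0 by simp
  qed
  then show ?thesis using p(1) min by blast
qed

text \<open>If the coordinate \<open>v\<close> is transcendental on \<open>Z\<close> over those in \<open>U\<close>, almost every value of it
  will do. Otherwise \<open>f\<close> below is, up to denominators, its minimal polynomial and \<open>w\<close> a generator of
  the ideal of \<open>f\<close> and \<open>q\<close>, where \<open>s = q(v)\<close>; as \<open>s\<close> is nonzero, \<open>w\<close> is a constant \<open>e\<close>, and the new
  coordinate may be any root of \<open>f\<close> as soon as \<open>e\<close> and the leading coefficient of \<open>f\<close> are nonzero.\<close>

lemma extend_coordinate:
  assumes v: "v \<notin> U" and s: "s \<in> coord_alg (insert v U)" "\<not> vanishes_on Z s"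
  shows "\<exists>r\<in>coord_alg U. \<not> vanishes_on Z r \<and>
    (\<forall>y. closure_point Z U y \<longrightarrow> r y \<noteq> 0 \<longrightarrow> (\<exists>c. closure_point Z (insert v U) (y(v := c)) \<and> s (y(v := c)) \<noteq> 0))"
proof -
  interpret R: subring_set "coord_alg U"
    unfolding coord_alg_def by (rule fun_alg.subring_set_axioms)
  interpret P: subring_set "polys_in (coord_alg U)"
    by (rule R.subring_set_polys_in)
  let ?R = "coord_alg U" and ?t = "\<lambda>x. x v"
  have R: "?R \<subseteq> coord_alg UNIV" by (rule coord_alg_mono) simp
  have polyR: "poly p ?t \<in> coord_alg UNIV" if "p \<in> polys_in ?R" for p
    using that coord_alg_mono[of "insert v U" UNIV] by (auto simp: coord_alg_insert adjoin_def)
  \<comment> \<open>The relations that the coordinate \<open>v\<close> satisfies on \<open>Z\<close>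
    over the coordinates in \<open>U\<close>.\<close>
  define J where "J p \<longleftrightarrow> p \<in> polys_in ?R \<and> vanishes_on Z (poly p ?t)" for p
  obtain q where q: "q \<in> polys_in ?R" "s = poly q ?t"
    using s(1) by (auto simp: coord_alg_insert adjoin_def)
  have constR: "c (y(v := d)) = c y" if "c \<in> ?R" for c y d
    by (rule coord_alg_cong[OF that]) (use v in auto)
  have ev: "poly p ?t (y(v := c)) = poly (map_poly (\<lambda>c. c y) p) c" if "p \<in> polys_in ?R" for p y c
  proof -
    have "map_poly (\<lambda>c. c (y(v := c'))) p = map_poly (\<lambda>c. c y) p" for c'
      using that by (intro poly_eqI) (simp add: coeff_map_poly polys_in_def constR)
    then show ?thesis by (simp add: poly_fun_apply[of p])
  qed
  have triv: "poly p ?t (y(v := c)) = 0"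
    if "p \<in> polys_in ?R" "trivial_poly p" "closure_point Z U y" for p y c
  proof -
    have "map_poly (\<lambda>c. c y) p = 0"
      using that by (intro poly_eqI)
        (auto simp: coeff_map_poly trivial_poly_def polys_in_def closure_point_def)
    then show ?thesis using ev[OF that(1)] by simp
  qed
  show ?thesis
  proof (cases "\<forall>p. J p \<longrightarrow> trivial_poly p")
    \<comment> \<open>Transcendental case: some coefficient of \<open>q\<close> serves as
      \<open>r\<close>. Where it is nonzero, \<open>q\<close> specialised at \<open>y\<close> is a
      nonzero polynomial and some \<open>c\<close> is not a root of it. All relations are trivial,
      so any \<open>c\<close> stays in the closure.\<close>
    case True
    have "\<not> trivial_poly q" using s(2) q(2) vanishes_on_trivial_poly by blast
    then obtain i where i: "\<not> vanishes_on Z (coeff q i)" by (auto simp: trivial_poly_def)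
    show ?thesis
    proof (intro bexI[of _ "coeff q i"] conjI allI impI i)
      show "coeff q i \<in> ?R" using q by (simp add: polys_in_def)
      fix y assume y: "closure_point Z U y" "coeff q i y \<noteq> 0"
      let ?p = "map_poly (\<lambda>c. c y) q"
      have "coeff ?p i \<noteq> 0" using y(2) by (simp add: coeff_map_poly)
      then have "?p \<noteq> 0" by auto
      then obtain c where c: "poly ?p c \<noteq> 0" using poly_all_0_iff_0[of ?p] by blast
      have "closure_point Z (insert v U) (y(v := c))"
        unfolding closure_point_def
      proof (intro ballI impI)
        fix f assume f: "f \<in> coord_alg (insert v U)" "vanishes_on Z f"
        then obtain p where p: "p \<in> polys_in ?R" "f = poly p ?t"
          by (auto simp: coord_alg_insert adjoin_def)
        then have "trivial_poly p" using True f(2) by (simp add: J_def)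
        then show "f (y(v := c)) = 0" using triv p y(1) by simp
      qed
      moreover have "s (y(v := c)) \<noteq> 0" unfolding q(2) ev[OF q(1)] by (rule c)
      ultimately show "\<exists>c. closure_point Z (insert v U) (y(v := c)) \<and> s (y(v := c)) \<noteq> 0" by blast
    qed
  next
    case False
    then obtain p0 where p0: "J p0" "\<not> trivial_poly p0" by blast
    have Jdiff: "J (a - b)" if "J a" "J b" for a b
      using that by (auto simp: J_def vanishes_on_def intro: P.diff_mem)
    have Jmult: "J (a * b)" if "J a" "b \<in> polys_in ?R" for a b
      using that by (auto simp: J_def vanishes_on_def intro: P.mult_mem)
    have Jtriv: "J m" if "m \<in> polys_in ?R" "trivial_poly m" for m
      using that by (simp add: J_def vanishes_on_trivial_poly)
    have "\<exists>f. J f \<and> \<not> vanishes_on Z (lead_coeff f) \<and> (\<forall>g. J g \<longrightarrow> degree g < degree f \<longrightarrow> trivial_poly g)"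
      by (rule ex_minimal_poly[of J p0 U]) (use p0 Jdiff Jtriv in \<open>auto simp: J_def\<close>)
    then obtain f where f: "J f" "\<not> vanishes_on Z (lead_coeff f)"
      and fmin: "\<And>g. J g \<Longrightarrow> degree g < degree f \<Longrightarrow> trivial_poly g" by blast
    have fR: "f \<in> polys_in ?R" using f(1) by (simp add: J_def)
    have aR: "lead_coeff f \<in> ?R" using fR by (simp add: polys_in_def)
    \<comment> \<open>The ideal generated by the relations and \<open>q\<close>: polynomials whose
      value at the coordinate \<open>v\<close> is, on \<open>Z\<close>, a multiple of
      \<open>s\<close>.\<close>
    define J' where "J' p \<longleftrightarrow> p \<in> polys_in ?R \<and> (\<exists>h\<in>polys_in ?R. J (p - h * q))" for p
    have JJ': "J' p" if "J p" for p
      unfolding J'_def using that P.zero_mem by (auto simp: J_def intro!: bexI[of _ 0])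
    have J'q: "J' q"
      unfolding J'_def using q P.one_mem JJ'
      by (auto simp: J_def vanishes_on_def P.zero_mem intro!: bexI[of _ 1])
    have J'diff: "J' (a - b)" if "J' a" "J' b" for a b
    proof -
      from that obtain g h where gh: "g \<in> polys_in ?R" "J (a - g * q)" "h \<in> polys_in ?R" "J (b - h * q)"
        by (auto simp: J'_def)
      have "(a - g * q) - (b - h * q) = (a - b) - (g - h) * q" by (simp add: algebra_simps)
      then have "J ((a - b) - (g - h) * q)" using Jdiff[OF gh(2,4)] by (simp only:)
      moreover have "g - h \<in> polys_in ?R" "a - b \<in> polys_in ?R"
        using gh that by (auto simp: J'_def intro: P.diff_mem)
      ultimately show ?thesis unfolding J'_def by blast
    qed
    have J'mult: "J' (a * b)" if "J' a" "b \<in> polys_in ?R" for a b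
    proof -
      from that obtain g where g: "g \<in> polys_in ?R" "J (a - g * q)" by (auto simp: J'_def)
      have "(a - g * q) * b = a * b - (g * b) * q" by (simp add: algebra_simps)
      then have "J (a * b - (g * b) * q)" using Jmult[OF g(2) that(2)] by (simp only:)
      moreover have "g * b \<in> polys_in ?R" "a * b \<in> polys_in ?R"
        using g that by (auto simp: J'_def intro: P.mult_mem)
      ultimately show ?thesis unfolding J'_def by blast
    qed
    have f0: "\<not> trivial_poly f" using f(2) by (auto simp: trivial_poly_def)
    have "\<exists>w. J' w \<and> \<not> vanishes_on Z (lead_coeff w) \<and> (\<forall>g. J' g \<longrightarrow> degree g < degree w \<longrightarrow> trivial_poly g)"
    proof (rule ex_minimal_poly[of J' f U])
      show "J' (p - m)" if "J' p" "m \<in> polys_in ?R" "trivial_poly m" for p m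
        using J'diff[OF that(1) JJ'[OF Jtriv[OF that(2,3)]]] .
    qed (use JJ' f f0 in \<open>auto simp: J'_def\<close>)
    then obtain w where w: "J' w" "\<not> vanishes_on Z (lead_coeff w)"
      and wmin: "\<And>g. J' g \<Longrightarrow> degree g < degree w \<Longrightarrow> trivial_poly g" by blast
    have wR: "w \<in> polys_in ?R" using w(1) by (simp add: J'_def)
    let ?b = "lead_coeff w"
    have bR: "?b \<in> ?R" using wR by (simp add: polys_in_def)
    have constP: "[:?b ^ N:] \<in> polys_in ?R" for N
      by (intro R.const_mem R.power_mem bR)
    have bN: "\<not> vanishes_on Z (?b ^ N)" for N
      using not_vanishes_power w(2) bR R by blast
    have divw: "\<exists>N u w'. u \<in> polys_in ?R \<and> w' \<in> polys_in ?R \<and> trivial_poly w' \<and>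
        smult (?b ^ N) p = u * w + w' \<and> degree u \<le> degree p - degree w" if "J' p" for p
    proof -
      have "p \<in> polys_in ?R" using that by (simp add: J'_def)
      from R.pseudo_division[OF wR this] obtain N u w' where
        d: "u \<in> polys_in ?R" "w' \<in> polys_in ?R" "smult (?b ^ N) p = u * w + w'"
          "w' = 0 \<or> degree w' < degree w" "degree u \<le> degree p - degree w" by blast
      have "w' = p * [:?b ^ N:] - w * u" using d(3) by (simp add: algebra_simps)
      then have "J' w'" using J'diff J'mult that constP w(1) d(1) by metis
      then have "trivial_poly w'" using d(4) wmin trivial_poly_0 by blast
      then show ?thesis using d by blast
    qed
    have deg_le: "degree w \<le> degree f"
      using wmin[OF JJ'[OF f(1)]] f0 by (meson not_less)
    \<comment> \<open>Up to powers of \<open>?b\<close> and trivial remainders, \<open>w\<close>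
      divides both \<open>f\<close> and \<open>q\<close>. For the cofactor \<open>u\<close> of
      \<open>f\<close>, the product \<open>u * w\<close> is a relation, so by primality
      \<open>u\<close> or \<open>w\<close> is one. If \<open>w\<close> had positive degree, the
      first case would contradict minimality of \<open>f\<close>; the second would make
      \<open>s\<close> vanish on \<open>Z\<close>.\<close>
    have "degree w = 0"
    proof (rule ccontr)
      assume dw: "degree w \<noteq> 0"
      from divw[OF JJ'[OF f(1)]] obtain N u w' where
        d: "u \<in> polys_in ?R" "w' \<in> polys_in ?R" "trivial_poly w'" "smult (?b ^ N) f = u * w + w'"
          "degree u \<le> degree f - degree w" by blast
      have "u * w = f * [:?b ^ N:] - w'" using d(4) by (simp add: algebra_simps)
      then have "J (u * w)" using Jdiff Jmult f(1) constP Jtriv[OF d(2,3)] by metis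
      then have "vanishes_on Z (poly u ?t * poly w ?t)" by (simp add: J_def)
      then consider "vanishes_on Z (poly u ?t)" | "vanishes_on Z (poly w ?t)"
        using integral polyR d(1) wR by blast
      then show False
      proof cases
        case 1
        then have "J u" using d(1) by (simp add: J_def)
        moreover have "degree u < degree f" using d(5) dw deg_le by simp
        ultimately have "trivial_poly (u * w)" using fmin trivial_poly_mult by blast
        then have "vanishes_on Z (coeff (smult (?b ^ N) f) (degree f))"
          using d(3) unfolding d(4) by (auto simp: trivial_poly_def vanishes_on_def)
        then have "vanishes_on Z (?b ^ N * lead_coeff f)" by simp
        then show False using integral[of "?b ^ N" "lead_coeff f"] bN f(2) R R.power_mem[OF bR] aR by blast
      next
        case 2
        from divw[OF J'q] obtain N u w' where
          d: "u \<in> polys_in ?R" "w' \<in> polys_in ?R" "trivial_poly w'" "smult (?b ^ N) q = u * w + w'" by blast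
        have "?b ^ N * s = poly (smult (?b ^ N) q) ?t" by (simp add: q(2))
        also have "\<dots> = poly u ?t * poly w ?t + poly w' ?t" unfolding d(4) by simp
        finally have "vanishes_on Z (?b ^ N * s)"
          using 2 vanishes_on_trivial_poly[OF d(3), of ?t] by (auto simp: vanishes_on_def)
        then show False using integral[of "?b ^ N" s] bN s(2) R R.power_mem[OF bR] polyR[OF q(1)] q(2) by blast
      qed
    qed
    then obtain e where e: "w = [:e:]" by (rule degree_eq_zeroE)
    have eR: "e \<in> ?R" and e0: "\<not> vanishes_on Z e" using bR w(2) e by auto
    obtain h where h: "h \<in> polys_in ?R" "J ([:e:] - h * q)" using w(1) e by (auto simp: J'_def)
    \<comment> \<open>A constant relation vanishes on \<open>Z\<close>, the leading coefficient of
      \<open>f\<close> does not. Hence \<open>f\<close> specialised at \<open>y\<close> will have a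
      root.\<close>
    have df: "degree f > 0"
    proof (rule ccontr)
      assume "\<not> degree f > 0"
      then obtain c where "f = [:c:]" by (auto elim: degree_eq_zeroE)
      then show False using f by (simp add: J_def)
    qed
    let ?a = "lead_coeff f"
    show ?thesis
    proof (intro bexI[of _ "?a * e"] conjI allI impI)
      show "?a * e \<in> ?R" by (intro R.mult_mem aR eR)
      show "\<not> vanishes_on Z (?a * e)" using integral[of ?a e] f(2) e0 aR eR R by blast
      fix y assume y: "closure_point Z U y" "(?a * e) y \<noteq> 0"
      then have ay: "?a y \<noteq> 0" and ey: "e y \<noteq> 0" by auto
      let ?f = "map_poly (\<lambda>c. c y) f"
      have "coeff ?f (degree f) \<noteq> 0" using ay by (simp add: coeff_map_poly)
      then have "degree ?f > 0" using df le_degree[of ?f "degree f"] by linarith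
      then obtain c where c: "poly ?f c = 0" using alg_closed_imp_poly_has_root by blast
      let ?y = "y(v := c)"
      \<comment> \<open>Pseudo-division by the minimal relation: a power of \<open>?a\<close> times
        any relation is a multiple of \<open>f\<close> plus a trivial polynomial. It therefore
        vanishes at the root \<open>c\<close>, and \<open>?a\<close> can be cancelled at
        \<open>y\<close>.\<close>
      have ov: "closure_point Z (insert v U) ?y"
        unfolding closure_point_def
      proof (intro ballI impI)
        fix g assume g: "g \<in> coord_alg (insert v U)" "vanishes_on Z g"
        then obtain p where p: "p \<in> polys_in ?R" "g = poly p ?t"
          by (auto simp: coord_alg_insert adjoin_def)
        then have Jp: "J p" using g(2) by (simp add: J_def)
        from R.pseudo_division[OF fR p(1)] obtain N u w' where
          d: "u \<in> polys_in ?R" "w' \<in> polys_in ?R" "smult (?a ^ N) p = u * f + w'"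
            "w' = 0 \<or> degree w' < degree f" by blast
        have "w' = p * [:?a ^ N:] - f * u" using d(3) by (simp add: algebra_simps)
        moreover have "[:?a ^ N:] \<in> polys_in ?R" by (intro R.const_mem R.power_mem aR)
        ultimately have "J w'" using Jdiff Jmult Jp f(1) d(1) by metis
        then have "trivial_poly w'" using d(4) fmin trivial_poly_0 by blast
        then have "poly w' ?t ?y = 0" using triv d(2) y(1) by blast
        moreover have "poly f ?t ?y = 0" using ev[OF fR] c by simp
        moreover have "?a ^ N * g = poly u ?t * poly f ?t + poly w' ?t"
        proof -
          have "?a ^ N * g = poly (smult (?a ^ N) p) ?t" by (simp add: p(2))
          then show ?thesis unfolding d(3) by simp
        qed
        ultimately have "(?a ^ N * g) ?y = 0" by simp
        then show "g ?y = 0" using ay constR[OF aR] by (simp add: power_fun_apply)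
      qed
      \<comment> \<open>This relation also holds at the new point, so the nonzero number
        \<open>e y\<close> is there a multiple of \<open>s\<close>.\<close>
      have "poly ([:e:] - h * q) ?t \<in> coord_alg (insert v U)"
        unfolding coord_alg_insert adjoin_def by (rule imageI) (use h(2) in \<open>simp add: J_def\<close>)
      then have "poly ([:e:] - h * q) ?t ?y = 0" using h(2) ov unfolding closure_point_def J_def by blast
      then have "e y = poly h ?t ?y * s ?y" using constR[OF eR] q(2) by simp
      then have "s ?y \<noteq> 0" using ey by auto
      then show "\<exists>c. closure_point Z (insert v U) (y(v := c)) \<and> s (y(v := c)) \<noteq> 0" using ov by blast
    qed
  qed
qed

text \<open>The open condition \<open>s\<close> makes single steps composable: the function produced
  by eliminating one coordinate is the \<open>s\<close> imposed when eliminating the next. The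
  result says that the projection of the closure of \<open>Z\<close> contains a nonempty open part
  of the closure of the projection.\<close>

theorem extend_coordinates:
  assumes "finite W" "U \<inter> W = {}" "s \<in> coord_alg (U \<union> W)" "\<not> vanishes_on Z s"
  shows "\<exists>r\<in>coord_alg U. \<not> vanishes_on Z r \<and>
    (\<forall>y. closure_point Z U y \<longrightarrow> r y \<noteq> 0 \<longrightarrow> (\<exists>z. (\<forall>v. v \<notin> W \<longrightarrow> z v = y v) \<and> closure_point Z (U \<union> W) z \<and> s z \<noteq> 0))"
  using assms
proof (induction W arbitrary: s rule: finite_induct)
  case (insert v W)
  have "v \<notin> U \<union> W" using insert by blast
  from extend_coordinate[OF this, of s] insert.prems obtain s' where
    s': "s' \<in> coord_alg (U \<union> W)" "\<not> vanishes_on Z s'"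
    and ext1: "\<And>y. closure_point Z (U \<union> W) y \<Longrightarrow> s' y \<noteq> 0 \<Longrightarrow>
      \<exists>c. closure_point Z (insert v (U \<union> W)) (y(v := c)) \<and> s (y(v := c)) \<noteq> 0"
    by auto
  obtain r where r: "r \<in> coord_alg U" "\<not> vanishes_on Z r"
    and ext: "\<And>y. closure_point Z U y \<Longrightarrow> r y \<noteq> 0 \<Longrightarrow>
      \<exists>z. (\<forall>v. v \<notin> W \<longrightarrow> z v = y v) \<and> closure_point Z (U \<union> W) z \<and> s' z \<noteq> 0"
    using insert.IH[OF _ s'] insert.prems(1) by blast
  show ?case
  proof (intro bexI[of _ r] conjI allI impI r)
    fix y assume "closure_point Z U y" "r y \<noteq> 0"
    then obtain z where z: "\<forall>v. v \<notin> W \<longrightarrow> z v = y v" "closure_point Z (U \<union> W) z" "s' z \<noteq> 0"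
      using ext by blast
    then obtain c where "closure_point Z (insert v (U \<union> W)) (z(v := c))" "s (z(v := c)) \<noteq> 0"
      using ext1 by blast
    then show "\<exists>z. (\<forall>u. u \<notin> insert v W \<longrightarrow> z u = y u) \<and> closure_point Z (U \<union> insert v W) z \<and> s z \<noteq> 0"
      using z(1) by (intro exI[of _ "z(v := c)"]) auto
  qed
qed auto

end

section \<open>Zariski closures of sets of matrices\<close>

definition mat_alg :: "('a::field^'n^'n \<Rightarrow> 'a) set" where
  "mat_alg = fun_alg (range (\<lambda>(i, j) A. A $ i $ j))"

lemma entry_in_mat_alg: "(\<lambda>A. A $ i $ j) \<in> mat_alg"
  unfolding mat_alg_def by (rule fun_alg.gen) auto

lemma mat_alg_mult: "f \<in> mat_alg \<Longrightarrow> g \<in> mat_alg \<Longrightarrow> f * g \<in> mat_alg"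
  unfolding mat_alg_def by (rule fun_alg.mult)

lemma mat_alg_comp:
  assumes "f \<in> mat_alg" "\<And>i j. (\<lambda>y. h y $ i $ j) \<in> fun_alg F"
  shows "(\<lambda>y. f (h y)) \<in> fun_alg F"
  using assms(1) unfolding mat_alg_def by (rule fun_alg_comp) (use assms(2) in auto)

lemma matrix_mult_entry_in_fun_alg:
  assumes "\<And>i j. (\<lambda>y. f y $ i $ j) \<in> fun_alg F" "\<And>i j. (\<lambda>y. g y $ i $ j) \<in> fun_alg F"
  shows "(\<lambda>y. (f y ** g y) $ i $ j) \<in> fun_alg F"
proof -
  have "(\<Sum>k\<in>UNIV. (\<lambda>y. f y $ i $ k) * (\<lambda>y. g y $ k $ j)) \<in> fun_alg F"
    by (intro fun_alg.sum_mem fun_alg.mult assms)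
  moreover have "(\<Sum>k\<in>UNIV. (\<lambda>y. f y $ i $ k) * (\<lambda>y. g y $ k $ j)) = (\<lambda>y. (f y ** g y) $ i $ j)"
    by (rule ext) (simp add: sum_fun_apply matrix_matrix_mult_def)
  ultimately show ?thesis by simp
qed

lemma mat_alg_mult_left: "f \<in> mat_alg \<Longrightarrow> (\<lambda>A. f (B ** A)) \<in> mat_alg"
  unfolding mat_alg_def
  by (rule mat_alg_comp[unfolded mat_alg_def], assumption)
    (rule matrix_mult_entry_in_fun_alg, rule fun_alg.const, rule entry_in_mat_alg[unfolded mat_alg_def])

lemma mat_alg_mult_right: "f \<in> mat_alg \<Longrightarrow> (\<lambda>A. f (A ** B)) \<in> mat_alg"
  unfolding mat_alg_def
  by (rule mat_alg_comp[unfolded mat_alg_def], assumption)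
    (rule matrix_mult_entry_in_fun_alg, rule entry_in_mat_alg[unfolded mat_alg_def], rule fun_alg.const)

text \<open>Together with the converse \<open>mat_alg_imp_mat_eval\<close> this replaces formal
  polynomials by polynomial functions, to which the noetherian property of \<open>fun_alg\<close>
  applies.\<close>

lemma mat_eval_in_mat_alg: "(\<lambda>A. mat_eval A p) \<in> mat_alg"
proof (induction p rule: mpoly_induct)
  case zero
  then show ?case unfolding mat_alg_def mat_eval_def by (simp add: fun_alg.const)
next
  case (add m c p)
  let ?m = "\<Prod>v\<in>Poly_Mapping.keys m. (\<lambda>A. A $ fst v $ snd v) ^ Poly_Mapping.lookup m v"
  have "(\<lambda>_. c) * ?m + (\<lambda>A. mat_eval A p) \<in> mat_alg"
    using add entry_in_mat_alg unfolding mat_alg_def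
    by (intro fun_alg.add fun_alg.mult fun_alg.const fun_alg.prod_mem fun_alg.power_mem) auto
  moreover have "(\<lambda>_. c) * ?m + (\<lambda>A. mat_eval A p) = (\<lambda>A. mat_eval A (Poly_Mapping.single m c + p))"
    by (rule ext) (simp add: mat_eval_def mpoly_eval_add mpoly_eval_single prod_fun_apply
        power_fun_apply case_prod_unfold)
  ultimately show ?case by simp
qed

lemma mat_alg_imp_mat_eval:
  assumes "f \<in> mat_alg"
  shows "\<exists>p. f = (\<lambda>A. mat_eval A p)"
  using assms unfolding mat_alg_def
proof (induction rule: fun_alg.induct)
  case (const c)
  then show ?case
    by (intro exI[of _ "Poly_Mapping.single 0 c"]) (simp add: mat_eval_def mpoly_eval_single)
next
  case (gen f)
  then obtain i j where "f = (\<lambda>A. A $ i $ j)" by auto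
  then show ?case
    by (intro exI[of _ "Poly_Mapping.single (Poly_Mapping.single (i, j) 1) 1"])
      (simp add: mat_eval_def mpoly_eval_single)
next
  case (add f g)
  then obtain p q where "f = (\<lambda>A. mat_eval A p)" "g = (\<lambda>A. mat_eval A q)" by blast
  then show ?case
    by (intro exI[of _ "p + q"]) (simp add: mat_eval_def mpoly_eval_add plus_fun_def)
next
  case (mult f g)
  then obtain p q where "f = (\<lambda>A. mat_eval A p)" "g = (\<lambda>A. mat_eval A q)" by blast
  then show ?case
    by (intro exI[of _ "p * q"]) (simp add: mat_eval_mult times_fun_def)
qed

section \<open>The closure operator, translations and noetherianity\<close>

abbreviation zcl :: "('a::field^'n^'n) set \<Rightarrow> ('a^'n^'n) set" where
  "zcl V \<equiv> zariski closure_of V"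

lemma zcl_eq_zero_locus: "zcl V = zero_locus (vanishing_ideal V)"
proof (rule closure_of_unique)
  show "V \<subseteq> zero_locus (vanishing_ideal V)"
    by (auto simp: zero_locus_def vanishing_ideal_def)
  show "closedin zariski (zero_locus (vanishing_ideal V))"
    by (auto simp: closedin_zariski)
  show "zero_locus (vanishing_ideal V) \<subseteq> C" if "V \<subseteq> C" "closedin zariski C" for C
    using that by (auto simp: closedin_zariski zero_locus_def vanishing_ideal_def subset_iff)
qed

lemma in_zcl_iff:
  fixes V :: "('a::field^'n^'n) set"
  shows "A \<in> zcl V \<longleftrightarrow> (\<forall>f\<in>mat_alg. vanishes_on V f \<longrightarrow> f A = 0)"
proof
  assume A: "A \<in> zcl V"
  show "\<forall>f\<in>mat_alg. vanishes_on V f \<longrightarrow> f A = 0"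
  proof (intro ballI impI)
    fix f :: "'a^'n^'n \<Rightarrow> 'a" assume f: "f \<in> mat_alg" "vanishes_on V f"
    then obtain p where p: "f = (\<lambda>A. mat_eval A p)" using mat_alg_imp_mat_eval by blast
    then have "p \<in> vanishing_ideal V" using f(2) by (simp add: vanishing_ideal_def vanishes_on_def)
    then show "f A = 0" using A p by (simp add: zcl_eq_zero_locus zero_locus_def)
  qed
next
  assume "\<forall>f\<in>mat_alg. vanishes_on V f \<longrightarrow> f A = 0"
  then show "A \<in> zcl V"
    using mat_eval_in_mat_alg by (fastforce simp: zcl_eq_zero_locus zero_locus_def
        vanishing_ideal_def vanishes_on_def)
qed

lemma subset_zcl: "V \<subseteq> zcl V"
  by (simp add: closure_of_subset)

lemma zcl_minimal: "V \<subseteq> C \<Longrightarrow> closedin zariski C \<Longrightarrow> zcl V \<subseteq> C"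
  by (rule closure_of_minimal)

lemma vanishes_on_zcl: "f \<in> mat_alg \<Longrightarrow> vanishes_on V f \<Longrightarrow> A \<in> zcl V \<Longrightarrow> f A = 0"
  by (simp add: in_zcl_iff)

lemma not_in_closed:
  assumes "closedin zariski C" "A \<notin> C"
  shows "\<exists>f\<in>mat_alg. vanishes_on C f \<and> f A \<noteq> 0"
proof -
  have "zcl C = C" using assms(1) by (simp add: closure_of_closedin)
  then show ?thesis using assms(2) in_zcl_iff[of A C] by blast
qed

lemma closedin_vanishing:
  assumes "P \<subseteq> mat_alg"
  shows "closedin zariski {A. \<forall>f\<in>P. f A = 0}"
proof -
  let ?C = "{A. \<forall>f\<in>P. f A = 0}"
  have "f A = 0" if "A \<in> zcl ?C" "f \<in> P" for A f
    by (rule vanishes_on_zcl[OF _ _ that(1)]) (use assms that(2) in \<open>auto simp: vanishes_on_def\<close>)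
  then have "zcl ?C = ?C" using subset_zcl[of ?C] by blast
  then show ?thesis by (rule closure_of_eq[THEN iffD1])
qed

lemma closedin_zariski_singleton: "closedin zariski {A}"
proof -
  let ?P = "range (\<lambda>(i, j) B. B $ i $ j - A $ i $ j)"
  have "(\<lambda>B. B $ i $ j - A $ i $ j) \<in> mat_alg" for i j
    using fun_alg.diff_mem[OF entry_in_mat_alg[of i j, unfolded mat_alg_def] fun_alg.const[of "A $ i $ j"]]
    by (simp add: mat_alg_def fun_diff_def)
  then have "closedin zariski {B. \<forall>f\<in>?P. f B = 0}" by (intro closedin_vanishing) auto
  moreover have "{B. \<forall>f\<in>?P. f B = 0} = {A}" by (auto simp: vec_eq_iff)
  ultimately show ?thesis by simp
qed

text \<open>Equations for the translate arise from those of \<open>C\<close> by composing with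
  multiplication by the inverse \<open>B'\<close>.\<close>

lemma closedin_mult_image:
  assumes C: "closedin zariski C" and inv: "B' ** B = mat 1" "B ** B' = mat 1"
  shows "closedin zariski ((**) B ` C)"
proof -
  obtain P where P: "P \<subseteq> mat_alg" "C = {A. \<forall>f\<in>P. f A = 0}"
  proof
    show "{f\<in>mat_alg. vanishes_on C f} \<subseteq> mat_alg" by blast
    show "C = {A. \<forall>f\<in>{f\<in>mat_alg. vanishes_on C f}. f A = 0}"
      using not_in_closed[OF C] by (auto simp: vanishes_on_def)
  qed
  have eq: "B' ** (B ** A) = A" "B ** (B' ** A) = A" for A
    using inv by (simp_all add: matrix_mul_assoc)
  have "(**) B ` C = {A. \<forall>f\<in>(\<lambda>f A. f (B' ** A)) ` P. f A = 0}"
  proof (intro equalityI subsetI)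
    fix A assume "A \<in> {A. \<forall>f\<in>(\<lambda>f A. f (B' ** A)) ` P. f A = 0}"
    then have "B' ** A \<in> C" by (auto simp: P(2))
    then show "A \<in> (**) B ` C" using eq by (metis imageI)
  qed (auto simp: P(2) eq)
  moreover have "(\<lambda>f A. f (B' ** A)) ` P \<subseteq> mat_alg" using P(1) mat_alg_mult_left by blast
  ultimately show ?thesis by (simp only: closedin_vanishing)
qed

lemma zcl_mult_left:
  fixes V :: "('a::field^'n^'n) set"
  assumes "A \<in> zcl V" "(**) B ` V \<subseteq> W"
  shows "B ** A \<in> zcl W"
  unfolding in_zcl_iff
proof (intro ballI impI)
  fix f :: "'a^'n^'n \<Rightarrow> 'a" assume f: "f \<in> mat_alg" "vanishes_on W f"
  show "f (B ** A) = 0"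
    by (rule vanishes_on_zcl[OF mat_alg_mult_left[OF f(1)] _ assms(1)])
      (use f(2) assms(2) in \<open>auto simp: vanishes_on_def\<close>)
qed

lemma zcl_mult_right:
  fixes V :: "('a::field^'n^'n) set"
  assumes "A \<in> zcl V" "(\<lambda>A. A ** B) ` V \<subseteq> W"
  shows "A ** B \<in> zcl W"
  unfolding in_zcl_iff
proof (intro ballI impI)
  fix f :: "'a^'n^'n \<Rightarrow> 'a" assume f: "f \<in> mat_alg" "vanishes_on W f"
  show "f (A ** B) = 0"
    by (rule vanishes_on_zcl[OF mat_alg_mult_right[OF f(1)] _ assms(1)])
      (use f(2) assms(2) in \<open>auto simp: vanishes_on_def\<close>)
qed

text \<open>Commuting with a fixed matrix is a closed condition, so commutation passes to the
  closure in one variable at a time.\<close>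

lemma zcl_commute:
  assumes "\<And>a b. a \<in> V \<Longrightarrow> b \<in> W \<Longrightarrow> a ** b = b ** a" "a \<in> zcl V" "b \<in> zcl W"
  shows "a ** b = b ** a"
proof -
  have comm: "a ** b = b ** a" if "\<And>a. a \<in> V \<Longrightarrow> a ** b = b ** a" "a \<in> zcl V" for V a b
  proof -
    have mem: "(\<lambda>A. (A ** b) $ i $ j - (b ** A) $ i $ j) \<in> mat_alg" for i j
      using fun_alg.diff_mem[OF mat_alg_mult_right[OF entry_in_mat_alg[of i j], of b, unfolded mat_alg_def]
          mat_alg_mult_left[OF entry_in_mat_alg[of i j], of b, unfolded mat_alg_def]]
      by (simp add: mat_alg_def fun_diff_def)
    have "(a ** b) $ i $ j - (b ** a) $ i $ j = 0" for i j
      by (rule vanishes_on_zcl[OF mem _ that(2)]) (simp add: vanishes_on_def that(1))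
    then show ?thesis by (simp add: vec_eq_iff)
  qed
  have "b ** a = a ** b" if "a \<in> V" for a
    by (rule comm[OF _ assms(3)]) (use assms(1) that in simp)
  then show ?thesis using comm[of V b a] assms(2) by simp
qed

text \<open>A strictly descending chain yields functions \<open>f i\<close> vanishing on
  \<open>C (Suc i)\<close> but not on \<open>C i\<close>. By noetherianity some \<open>f n\<close>
  is a combination of its predecessors, and all of these vanish on \<open>C n\<close>.\<close>

lemma wf_closed_zariski:
  "wf {(C, D). closedin zariski C \<and> closedin zariski D \<and> C \<subset> (D :: ('a::field^'n^'n) set)}"
  unfolding wf_iff_no_infinite_down_chain
proof
  assume "\<exists>C. \<forall>i. (C (Suc i), C i) \<in>
    {(C, D). closedin zariski C \<and> closedin zariski D \<and> C \<subset> (D :: ('a^'n^'n) set)}"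
  then obtain C :: "nat \<Rightarrow> ('a^'n^'n) set" where "\<forall>i. (C (Suc i), C i) \<in>
    {(C, D). closedin zariski C \<and> closedin zariski D \<and> C \<subset> D}" ..
  then have C: "closedin zariski (C i)" "C (Suc i) \<subset> C i" for i by auto
  have "\<exists>f\<in>mat_alg. vanishes_on (C (Suc i)) f \<and> \<not> vanishes_on (C i) f" for i
  proof -
    obtain A where "A \<in> C i" "A \<notin> C (Suc i)" using C(2)[of i] by blast
    then show ?thesis
      using not_in_closed[OF C(1)[of "Suc i"], of A] unfolding vanishes_on_def by blast
  qed
  then obtain f where f: "\<And>i. f i \<in> mat_alg" "\<And>i. vanishes_on (C (Suc i)) (f i)"
      "\<And>i. \<not> vanishes_on (C i) (f i)" by metis
  have "noetherian_set (mat_alg :: ('a^'n^'n \<Rightarrow> 'a) set)"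
    unfolding mat_alg_def by (rule noetherian_fun_alg) simp
  then obtain n where n: "f n \<in> lin_span mat_alg (f ` {..<n})"
    unfolding noetherian_set_def using f(1) by (metis image_subsetI)
  have anti: "C j \<subseteq> C i" if "i \<le> j" for i j
    by (rule lift_Suc_antimono_le[OF _ that]) (use C(2) in blast)
  have "vanishes_on (C n) g" if "g \<in> lin_span mat_alg (f ` {..<n})" for g
    using that
  proof (induction rule: lin_span.induct)
    case (add x r m)
    then obtain i where i: "i < n" "m = f i" by auto
    then have "vanishes_on (C n) m" using f(2)[of i] anti[of "Suc i" n] by (auto simp: vanishes_on_def)
    then show ?case using add.IH by (simp add: vanishes_on_def)
  qed (simp add: vanishes_on_def)
  then show False using n f(3) by blast
qed

text \<open>Stated through the vanishing ideal so that it applies to sets that are not closed, in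
  particular to abstract groups, and depends only on the closure.\<close>

definition irreducible_set :: "('a::field^'n^'n) set \<Rightarrow> bool" where
  "irreducible_set V \<longleftrightarrow> V \<noteq> {} \<and> (\<forall>f\<in>mat_alg. \<forall>g\<in>mat_alg. vanishes_on V (f * g) \<longrightarrow>
     vanishes_on V f \<or> vanishes_on V g)"

lemma irreducible_set_cong:
  assumes "V \<subseteq> W" "W \<subseteq> zcl V"
  shows "irreducible_set V \<longleftrightarrow> irreducible_set W"
proof -
  have "vanishes_on V f \<longleftrightarrow> vanishes_on W f" if "f \<in> mat_alg" for f
    using assms that vanishes_on_zcl by (fastforce simp: vanishes_on_def)
  moreover have "V = {} \<longleftrightarrow> W = {}" using assms by auto
  ultimately show ?thesis by (auto simp: irreducible_set_def mat_alg_mult)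
qed

lemma irreducible_set_subset_Un:
  assumes V: "irreducible_set V" and closed: "closedin zariski C" "closedin zariski D"
    and sub: "V \<subseteq> C \<union> D"
  shows "V \<subseteq> C \<or> V \<subseteq> D"
proof (rule ccontr)
  assume "\<not> (V \<subseteq> C \<or> V \<subseteq> D)"
  then obtain A B where AB: "A \<in> V" "A \<notin> C" "B \<in> V" "B \<notin> D" by blast
  obtain f where f: "f \<in> mat_alg" "vanishes_on C f" "f A \<noteq> 0"
    using not_in_closed[OF closed(1) AB(2)] by blast
  obtain g where g: "g \<in> mat_alg" "vanishes_on D g" "g B \<noteq> 0"
    using not_in_closed[OF closed(2) AB(4)] by blast
  note fg = f g
  have "vanishes_on V (f * g)" using sub fg by (auto simp: vanishes_on_def)
  then have "vanishes_on V f \<or> vanishes_on V g" using V fg by (auto simp: irreducible_set_def)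
  then show False using AB fg by (auto simp: vanishes_on_def)
qed

lemma irreducible_set_subset_Union:
  assumes "irreducible_set V" "finite \<C>" "\<And>C. C \<in> \<C> \<Longrightarrow> closedin zariski C" "V \<subseteq> \<Union>\<C>"
  shows "\<exists>C\<in>\<C>. V \<subseteq> C"
  using assms(2-4)
proof (induction \<C> rule: finite_induct)
  case empty
  then show ?case using assms(1) by (auto simp: irreducible_set_def)
next
  case (insert C \<C>)
  have "closedin zariski (\<Union>\<C>)" using insert by (intro closedin_Union) auto
  then have "V \<subseteq> C \<or> V \<subseteq> \<Union>\<C>"
    using insert.prems assms(1) by (intro irreducible_set_subset_Un) auto
  then show ?case using insert by auto
qed

lemma irreducible_space_zariski:
  assumes "irreducible_set V"
  shows "irreducible_space (subtopology zariski V)"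
  unfolding irreducible_space_def
proof (intro conjI allI impI)
  show "topspace (subtopology zariski V) \<noteq> {}" using assms by (simp add: irreducible_set_def)
  fix A B
  assume AB: "closedin (subtopology zariski V) A \<and> closedin (subtopology zariski V) B \<and>
    topspace (subtopology zariski V) = A \<union> B"
  from AB obtain C where C: "closedin zariski C" "A = C \<inter> V"
    unfolding closedin_subtopology by blast
  from AB obtain D where D: "closedin zariski D" "B = D \<inter> V"
    unfolding closedin_subtopology by blast
  have "V = A \<union> B" using AB by simp
  then show "A = topspace (subtopology zariski V) \<or> B = topspace (subtopology zariski V)"
    using irreducible_set_subset_Un[OF assms C(1) D(1)] C(2) D(2) by auto
qed

lemma connectedin_irreducible_set: "irreducible_set V \<Longrightarrow> connectedin zariski V"
  unfolding connectedin_closedin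
proof (intro conjI notI)
  assume V: "irreducible_set V"
  assume "\<exists>C D. closedin zariski C \<and> closedin zariski D \<and> V \<subseteq> C \<union> D \<and> C \<inter> D \<inter> V = {} \<and>
    C \<inter> V \<noteq> {} \<and> D \<inter> V \<noteq> {}"
  then obtain C D where CD: "closedin zariski C" "closedin zariski D" "V \<subseteq> C \<union> D"
    "C \<inter> D \<inter> V = {}" "C \<inter> V \<noteq> {}" "D \<inter> V \<noteq> {}" by (elim exE conjE)
  from irreducible_set_subset_Un[OF V CD(1-3)] show False using CD(4-6) by blast
qed simp

lemma irreducible_set_mult_image:
  fixes V :: "('a::field^'n^'n) set"
  assumes "irreducible_set V"
  shows "irreducible_set ((**) B ` V)"
proof -
  have eq: "vanishes_on ((**) B ` V) f \<longleftrightarrow> vanishes_on V (\<lambda>A. f (B ** A))" for f :: "'a^'n^'n \<Rightarrow> 'a"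
    by (simp add: vanishes_on_def)
  have "(\<lambda>A. (f * g) (B ** A)) = (\<lambda>A. f (B ** A)) * (\<lambda>A. g (B ** A))" for f g :: "'a^'n^'n \<Rightarrow> 'a"
    by (simp add: times_fun_def)
  then show ?thesis
    using assms mat_alg_mult_left[of _ B] unfolding irreducible_set_def eq by auto
qed

text \<open>Noetherian induction on the closure. The two factors of a product vanishing on
  \<open>V\<close> cut \<open>V\<close> itself into pieces, which need not be closed; it is their
  closures that shrink strictly.\<close>

lemma finite_irreducible_decomposition:
  fixes V :: "('a::field^'n^'n) set"
  shows "\<exists>\<V>. finite \<V> \<and> V = \<Union>\<V> \<and> (\<forall>W\<in>\<V>. irreducible_set W)"
proof (induction "zcl V" arbitrary: V rule: wf_induct_rule[OF wf_closed_zariski])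
  case (1 V)
  show ?case
  proof (cases "irreducible_set V \<or> V = {}")
    case True
    then show ?thesis by (auto intro: exI[of _ "{V}"] exI[of _ "{}"])
  next
    case False
    then obtain f g where fg: "f \<in> mat_alg" "g \<in> mat_alg" "vanishes_on V (f * g)"
      "\<not> vanishes_on V f" "\<not> vanishes_on V g" by (auto simp: irreducible_set_def)
    have step: "\<exists>\<V>. finite \<V> \<and> V \<inter> {A. f A = 0} = \<Union>\<V> \<and> (\<forall>W\<in>\<V>. irreducible_set W)"
      if "f \<in> mat_alg" "\<not> vanishes_on V f" for f
    proof (rule 1)
      have "vanishes_on (V \<inter> {A. f A = 0}) f" by (simp add: vanishes_on_def)
      then have "f A = 0" if "A \<in> zcl (V \<inter> {A. f A = 0})" for A
        using vanishes_on_zcl[OF \<open>f \<in> mat_alg\<close>] that by blast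
      then have "\<not> V \<subseteq> zcl (V \<inter> {A. f A = 0})"
        using that(2) unfolding vanishes_on_def by blast
      moreover have "zcl (V \<inter> {A. f A = 0}) \<subseteq> zcl V" by (intro closure_of_mono) blast
      ultimately show "(zcl (V \<inter> {A. f A = 0}), zcl V) \<in>
          {(C, D). closedin zariski C \<and> closedin zariski D \<and> C \<subset> D}"
        using subset_zcl[of V] by auto
    qed
    obtain \<V> \<W> where
      "finite \<V> \<and> V \<inter> {A. f A = 0} = \<Union>\<V> \<and> (\<forall>W\<in>\<V>. irreducible_set W)"
      "finite \<W> \<and> V \<inter> {A. g A = 0} = \<Union>\<W> \<and> (\<forall>W\<in>\<W>. irreducible_set W)"
      using step fg by metis
    moreover have "V = (V \<inter> {A. f A = 0}) \<union> (V \<inter> {A. g A = 0})"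
      using fg(3) by (auto simp: vanishes_on_def)
    ultimately show ?thesis by (intro exI[of _ "\<V> \<union> \<W>"]) auto
  qed
qed

text \<open>Points are closed, so a point and the whole set form a chain of length one.\<close>

lemma zariski_dim_pos:
  assumes "irreducible_set V" "infinite V"
  shows "zariski_dim V > 0"
proof -
  obtain A where A: "A \<in> V" using assms(2) by (metis ex_in_conv infinite_imp_nonempty)
  let ?T = "subtopology zariski V" and ?Z = "\<lambda>i::nat. if i = 0 then {A} else V"
  have "irreducible_set {A}" by (auto simp: irreducible_set_def vanishes_on_def)
  then have "irreducible_space (subtopology zariski {A})" by (rule irreducible_space_zariski)
  moreover have "subtopology ?T {A} = subtopology zariski {A}" "subtopology ?T V = ?T"
    using A by (simp_all add: subtopology_subtopology insert_absorb Int_absorb1)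
  moreover have "closedin ?T {A}" "closedin ?T V"
    using A closedin_subset_topspace[OF closedin_zariski_singleton[of A]] closedin_topspace[of ?T] by auto
  moreover have "{A} \<subset> V"
    using A assms(2) by (metis finite.emptyI finite.insertI insert_subset empty_subsetI psubsetI)
  ultimately have "(\<forall>i\<le>1. closedin ?T (?Z i) \<and> irreducible_space (subtopology ?T (?Z i))) \<and>
     (\<forall>i<1. ?Z i \<subset> ?Z (Suc i))"
    using irreducible_space_zariski[OF assms(1)] by simp
  then have "enat 1 \<le> krull_dim ?T"
    unfolding krull_dim_def
    by (intro Sup_upper CollectI exI[of _ "1::nat"] exI[of _ ?Z] conjI refl) simp_all
  then show ?thesis unfolding zariski_dim_def
    by (auto simp: zero_enat_def intro: less_le_trans[rotated])
qed

section \<open>Closures of matrix groups\<close>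

lemma mult_GL [simp]: "A \<otimes>\<^bsub>GL\<^esub> B = A ** B"
  by (simp add: GL_def)

lemma one_GL [simp]: "\<one>\<^bsub>GL\<^esub> = mat 1"
  by (simp add: GL_def)

lemma carrier_GL: "A \<in> carrier GL \<longleftrightarrow> invertible A"
  by (simp add: GL_def)

lemma subgroup_GL_iff:
  fixes H :: "('a::field^'n^'n) set"
  shows "subgroup H GL \<longleftrightarrow> mat 1 \<in> H \<and> (\<forall>a\<in>H. \<forall>b\<in>H. a ** b \<in> H) \<and>
    (\<forall>a\<in>H. \<exists>b\<in>H. a ** b = mat 1 \<and> b ** a = mat 1)"
proof -
  interpret G: group "GL :: ('a^'n^'n) monoid" by (rule group_GL)
  show ?thesis
  proof
    assume H: "subgroup H GL"
    have "a ** inv\<^bsub>GL\<^esub> a = mat 1 \<and> inv\<^bsub>GL\<^esub> a ** a = mat 1" if "a \<in> H" for a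
      using G.r_inv[of a] G.l_inv[of a] subgroup.mem_carrier[OF H that] by simp
    then show "mat 1 \<in> H \<and> (\<forall>a\<in>H. \<forall>b\<in>H. a ** b \<in> H) \<and>
        (\<forall>a\<in>H. \<exists>b\<in>H. a ** b = mat 1 \<and> b ** a = mat 1)"
      using subgroup.one_closed[OF H] subgroup.m_closed[OF H] subgroup.m_inv_closed[OF H]
      by (metis mult_GL one_GL)
  next
    assume H: "mat 1 \<in> H \<and> (\<forall>a\<in>H. \<forall>b\<in>H. a ** b \<in> H) \<and>
        (\<forall>a\<in>H. \<exists>b\<in>H. a ** b = mat 1 \<and> b ** a = mat 1)"
    then have sub: "H \<subseteq> carrier GL" unfolding carrier_GL[abs_def] subset_iff by (metis carrier_GL invertible_def)
    have "inv\<^bsub>GL\<^esub> a \<in> H" if a: "a \<in> H" for a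
    proof -
      from H a obtain b where "b \<in> H" "b ** a = mat 1" by blast
      then have "inv\<^bsub>GL\<^esub> a = b" using sub a by (intro G.inv_equality) auto
      then show ?thesis using \<open>b \<in> H\<close> by simp
    qed
    then show "subgroup H GL" using H sub by (intro subgroup.intro) auto
  qed
qed

lemma subgroup_GL_inverse:
  "subgroup H GL \<Longrightarrow> a \<in> H \<Longrightarrow> \<exists>b\<in>H. a ** b = mat 1 \<and> b ** a = mat 1"
  by (simp add: subgroup_GL_iff)

lemma cancel_inverse:
  fixes a b :: "'a::field^'n^'n"
  assumes "b ** a = mat 1"
  shows "b ** (a ** x) = x"
  using assms by (simp add: matrix_mul_assoc)

text \<open>Inversion is not polynomial on the space of all matrices. Instead, multiplication by an
  invertible \<open>a\<close> in the closure maps the closure into itself; were the image smaller,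
  iterating would give an infinite strictly descending chain of closed sets. So the identity has a
  preimage, the inverse of \<open>a\<close>.\<close>

lemma subgroup_GL_zcl:
  fixes H :: "('a::field^'n^'n) set"
  assumes H: "subgroup H GL"
  shows "subgroup (zcl H \<inter> carrier GL) GL"
  unfolding subgroup_GL_iff
proof (intro conjI ballI)
  have one: "mat 1 \<in> H" and mult: "\<And>a b. a \<in> H \<Longrightarrow> b \<in> H \<Longrightarrow> a ** b \<in> H"
    using H by (auto simp: subgroup_GL_iff)
  have "invertible (mat 1 :: 'a^'n^'n)" unfolding invertible_def by (intro exI[of _ "mat 1"]) simp
  then show "mat 1 \<in> zcl H \<inter> carrier GL" using one subset_zcl by (auto simp: carrier_GL)
  have "a ** c \<in> zcl H" if "a \<in> H" "c \<in> zcl H" for a c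
    by (rule zcl_mult_left[OF that(2)]) (use mult that(1) in blast)
  then have zcl_mult: "c ** d \<in> zcl H" if "c \<in> zcl H" "d \<in> zcl H" for c d
    using zcl_mult_right[OF that(1), of d "zcl H"] that(2) by auto
  fix a assume a: "a \<in> zcl H \<inter> carrier GL"
  show "a ** b \<in> zcl H \<inter> carrier GL" if "b \<in> zcl H \<inter> carrier GL" for b
    using a that zcl_mult by (auto simp: carrier_GL invertible_mult)
  obtain a' where a': "a ** a' = mat 1" "a' ** a = mat 1"
    using a by (auto simp: carrier_GL invertible_def)
  let ?m = "(**) a"
  have inj: "inj ?m" using cancel_inverse[OF a'(2)] by (metis injI)
  have "?m ` zcl H = zcl H"
  proof (rule ccontr)
    assume neq: "?m ` zcl H \<noteq> zcl H"
    have sub: "?m ` zcl H \<subset> zcl H" using neq zcl_mult a by blast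
    have closed: "closedin zariski ((?m ^^ n) ` zcl H)" for n
    proof (induction n)
      case (Suc n)
      then show ?case using closedin_mult_image[OF Suc a'(2,1)] by (simp add: image_comp)
    qed simp
    have strict: "(?m ^^ Suc n) ` zcl H \<subset> (?m ^^ n) ` zcl H" for n
    proof (induction n)
      case (Suc n)
      have "?m ` (?m ^^ Suc n) ` zcl H \<subset> ?m ` (?m ^^ n) ` zcl H"
        by (rule image_strict_mono[OF inj_on_subset[OF inj subset_UNIV] Suc])
      then show ?case by (simp add: image_comp)
    qed (use sub in simp)
    have "((?m ^^ Suc i) ` zcl H, (?m ^^ i) ` zcl H) \<in>
      {(C, D). closedin zariski C \<and> closedin zariski D \<and> C \<subset> (D :: ('a^'n^'n) set)}" for i
      by (simp only: mem_Collect_eq case_prod_conv closed strict simp_thms)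
    then have "\<exists>f. \<forall>i. (f (Suc i), f i) \<in>
      {(C, D). closedin zariski C \<and> closedin zariski D \<and> C \<subset> (D :: ('a^'n^'n) set)}"
      by (intro exI[of _ "\<lambda>n. (?m ^^ n) ` zcl H"] allI)
    then show False
      using wf_closed_zariski[where 'a='a and 'n='n] unfolding wf_iff_no_infinite_down_chain by blast
  qed
  then obtain b where b: "b \<in> zcl H" "a ** b = mat 1"
    using subset_zcl one by (metis (no_types, lifting) imageE subsetD)
  have "b = a'" using cancel_inverse[OF a'(2), of b] b(2) by simp
  then show "\<exists>b\<in>zcl H \<inter> carrier GL. a ** b = mat 1 \<and> b ** a = mat 1"
    using b(1) a' by (intro bexI[of _ b]) (auto simp: carrier_GL invertible_def)
qed

text \<open>Left cosets fit the action on irreducible components by left translation.\<close>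

definition finite_index :: "('a::field^'n^'n) set \<Rightarrow> ('a^'n^'n) set \<Rightarrow> bool" where
  "finite_index K H \<longleftrightarrow> (\<exists>T. finite T \<and> T \<subseteq> H \<and> H \<subseteq> (\<Union>t\<in>T. (**) t ` K))"

lemma finite_index_trans:
  assumes "finite_index L K" "finite_index K H" "K \<subseteq> H" "\<And>a b. a \<in> H \<Longrightarrow> b \<in> H \<Longrightarrow> a ** b \<in> H"
  shows "finite_index L H"
proof -
  obtain S T where S: "finite S" "S \<subseteq> K" "K \<subseteq> (\<Union>t\<in>S. (**) t ` L)"
    and T: "finite T" "T \<subseteq> H" "H \<subseteq> (\<Union>t\<in>T. (**) t ` K)"
    using assms(1,2) by (auto simp: finite_index_def)
  show ?thesis unfolding finite_index_def
  proof (intro exI[of _ "(\<lambda>(t, s). t ** s) ` (T \<times> S)"] conjI subsetI)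
    show "finite ((\<lambda>(t, s). t ** s) ` (T \<times> S))" using S T by simp
    show "x \<in> H" if x: "x \<in> (\<lambda>(t, s). t ** s) ` (T \<times> S)" for x
    proof -
      obtain t s' where "t \<in> T" "s' \<in> S" "x = t ** s'" using x by auto
      then show ?thesis using S(2) T(2) assms(3) by (auto intro: assms(4))
    qed
    fix x assume "x \<in> H"
    then obtain t k where t: "t \<in> T" "k \<in> K" "x = t ** k" using T(3) by blast
    then obtain s l where s: "s \<in> S" "l \<in> L" "k = s ** l" using S(3) by blast
    have "x = (t ** s) ** l" using t s by (simp add: matrix_mul_assoc)
    then show "x \<in> (\<Union>u\<in>(\<lambda>(t, s). t ** s) ` (T \<times> S). (**) u ` L)" using t s by blast
  qed
qed

lemma finite_index_infinite:
  assumes "finite_index K H" "infinite H"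
  shows "infinite K"
proof
  assume "finite K"
  obtain T where T: "finite T" "H \<subseteq> (\<Union>t\<in>T. (**) t ` K)"
    using assms(1) by (auto simp: finite_index_def)
  then have "finite H" using \<open>finite K\<close> by (elim finite_subset) simp
  then show False using assms(2) by simp
qed

text \<open>Choose a subgroup of finite index with least Zariski closure. It permutes the finitely many
  irreducible components of its closure. By minimality the stabilizer of all components is
  still dense, and it is contained in any component through the identity.\<close>

theorem ex_irreducible_finite_index:
  fixes H :: "('a::field^'n^'n) set"
  assumes H: "subgroup H GL"
  shows "\<exists>K. subgroup K GL \<and> K \<subseteq> H \<and> finite_index K H \<and> irreducible_set K"
proof -
  define Q where "Q K \<longleftrightarrow> subgroup K GL \<and> K \<subseteq> H \<and> finite_index K H" for K
  have "Q H" unfolding Q_def finite_index_def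
    using H by (auto simp: subgroup_GL_iff intro!: exI[of _ "{mat 1}"] image_eqI[of _ "(**) (mat 1)"])
  then have "zcl H \<in> zcl ` {K. Q K}" by blast
  then obtain C where C: "C \<in> zcl ` {K. Q K}"
    and Cmin: "\<And>D. (D, C) \<in> {(C, D). closedin zariski C \<and> closedin zariski D \<and> C \<subset> (D :: ('a^'n^'n) set)}
      \<Longrightarrow> D \<notin> zcl ` {K. Q K}"
    by (rule wfE_min[OF wf_closed_zariski]) blast
  then obtain K where K: "Q K" "C = zcl K" by blast
  have min: "zcl L = zcl K" if "Q L" "L \<subseteq> K" for L
  proof (rule ccontr)
    assume "zcl L \<noteq> zcl K"
    then have "zcl L \<subset> zcl K" using closure_of_mono[OF that(2), of zariski] by blast
    then have "(zcl L, C) \<in> {(C, D). closedin zariski C \<and> closedin zariski D \<and> C \<subset> D}"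
      using K(2) by simp
    from Cmin[OF this] show False using that(1) by blast
  qed
  have Ksub: "subgroup K GL" and KH: "K \<subseteq> H" using K(1) by (auto simp: Q_def)
  have one: "mat 1 \<in> K" and mult: "\<And>a b. a \<in> K \<Longrightarrow> b \<in> K \<Longrightarrow> a ** b \<in> K"
    using Ksub by (auto simp: subgroup_GL_iff)
  obtain \<V> where V: "finite \<V>" "K = \<Union>\<V>" "\<forall>W\<in>\<V>. irreducible_set W"
    using finite_irreducible_decomposition by metis
  define \<Y> where "\<Y> = (\<lambda>W. zcl W) ` \<V>"
  have Yfin: "finite \<Y>" using V by (simp add: \<Y>_def)
  have Ycl: "closedin zariski Y" and Yirr: "irreducible_set Y" and YK: "Y \<subseteq> zcl K" if Y: "Y \<in> \<Y>" for Y
  proof -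
    obtain W where W: "W \<in> \<V>" "Y = zcl W" using Y unfolding \<Y>_def by blast
    show "closedin zariski Y" using W by simp
    show "irreducible_set Y" using irreducible_set_cong[of W Y] W V(3) subset_zcl[of W] by simp
    have "W \<subseteq> K" using W V(2) by blast
    then show "Y \<subseteq> zcl K" unfolding W(2) by (rule closure_of_mono)
  qed
  have Kcov: "zcl K \<subseteq> \<Union>\<Y>"
  proof (rule zcl_minimal)
    show "K \<subseteq> \<Union>\<Y>" using V(2) subset_zcl unfolding \<Y>_def by blast
    show "closedin zariski (\<Union>\<Y>)" using Yfin Ycl by (intro closedin_Union)
  qed
  have cov: "\<exists>Y\<in>\<Y>. W \<subseteq> Y" if "irreducible_set W" "W \<subseteq> zcl K" for W
    using irreducible_set_subset_Union[OF that(1) Yfin Ycl] that(2) Kcov by blast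
  have stable: "(**) a ` zcl K \<subseteq> zcl K" if "a \<in> K" for a
    using zcl_mult_left[of _ K a K] mult that by blast
  \<comment> \<open>The decomposition may be redundant; its maximal closures are the irreducible
    components.\<close>
  define \<M> where "\<M> = {Y\<in>\<Y>. \<forall>Y'\<in>\<Y>. Y \<subseteq> Y' \<longrightarrow> Y' = Y}"
  have Mfin: "finite \<M>" using Yfin by (simp add: \<M>_def)
  \<comment> \<open>Translating \<open>Y'\<close> back gives an irreducible set containing
    \<open>Y\<close> and contained in some member of \<open>\<Y>\<close>; maximality of
    \<open>Y\<close> closes the sandwich.\<close>
  have eq: "(**) a ` Y = Y'" if a: "a \<in> K" and Y: "Y \<in> \<M>" "Y' \<in> \<Y>" "(**) a ` Y \<subseteq> Y'" for a Y Y'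
  proof -
    obtain b where b: "b \<in> K" "a ** b = mat 1" "b ** a = mat 1"
      using subgroup_GL_inverse[OF Ksub a] by blast
    have "irreducible_set ((**) b ` Y')" by (intro irreducible_set_mult_image Yirr Y)
    moreover have "(**) b ` Y' \<subseteq> zcl K" using YK[OF Y(2)] stable[OF b(1)] by blast
    ultimately obtain Y'' where Y'': "Y'' \<in> \<Y>" "(**) b ` Y' \<subseteq> Y''" using cov by blast
    have sub: "Y \<subseteq> (**) b ` Y'"
    proof
      fix y assume "y \<in> Y"
      then have "a ** y \<in> Y'" using Y(3) by blast
      then show "y \<in> (**) b ` Y'" using cancel_inverse[OF b(3), of y] by (metis imageI)
    qed
    then have "Y'' = Y" using Y(1) Y'' by (auto simp: \<M>_def)
    then have "(**) b ` Y' = Y" using Y'' sub by blast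
    then have "(**) a ` Y = (**) a ` (**) b ` Y'" by simp
    also have "\<dots> = Y'" by (simp add: image_image cancel_inverse[OF b(2)])
    finally show ?thesis .
  qed
  have perm: "(**) a ` Y \<in> \<M>" if a: "a \<in> K" and Y: "Y \<in> \<M>" for a Y
  proof -
    have Y0: "Y \<in> \<Y>" using Y by (simp add: \<M>_def)
    have "(**) a ` Y \<subseteq> zcl K" using YK[OF Y0] stable[OF a] by blast
    then obtain Y' where Y': "Y' \<in> \<Y>" "(**) a ` Y \<subseteq> Y'"
      using cov irreducible_set_mult_image[OF Yirr[OF Y0]] by blast
    have aY: "(**) a ` Y = Y'" by (rule eq[OF a Y Y'])
    have "Z = Y'" if "Z \<in> \<Y>" "Y' \<subseteq> Z" for Z
      using eq[OF a Y that(1)] that(2) aY by simp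
    then show ?thesis using Y'(1) aY by (auto simp: \<M>_def)
  qed
  define L where "L = {a\<in>K. \<forall>Y\<in>\<M>. (**) a ` Y = Y}"
  have LK: "L \<subseteq> K" by (auto simp: L_def)
  have Lsub: "subgroup L GL"
    unfolding subgroup_GL_iff
  proof (intro conjI ballI)
    show "mat 1 \<in> L" using one by (simp add: L_def)
    fix a assume a: "a \<in> L"
    then have aK: "a \<in> K" and aY: "\<And>Y. Y \<in> \<M> \<Longrightarrow> (**) a ` Y = Y" by (auto simp: L_def)
    show "a ** b \<in> L" if "b \<in> L" for b
    proof -
      have "(**) (a ** b) ` Y = (**) a ` (**) b ` Y" for Y :: "('a^'n^'n) set"
        by (simp add: image_image matrix_mul_assoc)
      then show ?thesis using that aK aY mult by (simp add: L_def)
    qed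
    obtain b where b: "b \<in> K" "a ** b = mat 1" "b ** a = mat 1"
      using subgroup_GL_inverse[OF Ksub aK] by blast
    have "(**) b ` Y = Y" if "Y \<in> \<M>" for Y
    proof -
      have "(**) b ` Y = (**) b ` (**) a ` Y" using aY[OF that] by simp
      also have "\<dots> = Y" by (simp add: image_image cancel_inverse[OF b(3)])
      finally show ?thesis .
    qed
    then show "\<exists>b\<in>L. a ** b = mat 1 \<and> b ** a = mat 1" using b by (auto simp: L_def)
  qed
  have "finite_index L K"
  proof -
    \<comment> \<open>Elements of \<open>K\<close> inducing the same permutation of the finite set
      \<open>\<M>\<close> differ by an element of \<open>L\<close>, so one representative per
      permutation is enough.\<close>
    let ?p = "\<lambda>a. restrict (\<lambda>Y. (**) a ` Y) \<M>"
    have "?p ` K \<subseteq> \<M> \<rightarrow>\<^sub>E \<M>" using perm by auto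
    then have fin: "finite (?p ` K)" using Mfin finite_PiE[of \<M> "\<lambda>_. \<M>"] by (blast intro: finite_subset)
    then obtain T where T: "T \<subseteq> K" "finite T" "?p ` K = ?p ` T"
      using finite_subset_image[OF fin, of ?p K] by auto
    have "a \<in> (\<Union>t\<in>T. (**) t ` L)" if a: "a \<in> K" for a
    proof -
      obtain t where t: "t \<in> T" "?p a = ?p t" using a T(3) by blast
      then have tK: "t \<in> K" using T(1) by blast
      obtain s where s: "s \<in> K" "t ** s = mat 1" "s ** t = mat 1"
        using subgroup_GL_inverse[OF Ksub tK] by blast
      have "(**) (s ** a) ` Y = Y" if "Y \<in> \<M>" for Y
      proof -
        have "(**) a ` Y = (**) t ` Y" using fun_cong[OF t(2), of Y] that by simp
        then have "(**) s ` (**) a ` Y = (**) s ` (**) t ` Y" by simp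
        also have "\<dots> = Y" by (simp add: image_image cancel_inverse[OF s(3)])
        finally show ?thesis by (simp add: image_image matrix_mul_assoc)
      qed
      then have "s ** a \<in> L" using mult s(1) a by (simp add: L_def)
      moreover have "a = t ** (s ** a)" by (rule cancel_inverse[OF s(2), symmetric])
      ultimately show ?thesis using t(1) by blast
    qed
    then show ?thesis using T unfolding finite_index_def by blast
  qed
  then have "finite_index L H"
    using K(1) H by (intro finite_index_trans[of L K H]) (auto simp: Q_def subgroup_GL_iff)
  then have QL: "Q L" using Lsub LK KH by (auto simp: Q_def)
  then have zL: "zcl L = zcl K" using LK by (rule min)
  obtain Y0 where Y0: "Y0 \<in> \<Y>" "mat 1 \<in> Y0" using one subset_zcl[of K] Kcov by blast
  obtain Y where Y: "Y \<in> \<Y>" "Y0 \<subseteq> Y" "\<forall>Y'\<in>\<Y>. Y \<subseteq> Y' \<longrightarrow> Y' = Y"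
    using finite_has_maximal2[OF Yfin Y0(1)] by auto
  then have "Y \<in> \<M>" by (simp add: \<M>_def)
  \<comment> \<open>Then \<open>Y\<close> lies between \<open>L\<close> and the closure of
    \<open>L\<close>, and irreducibility passes from \<open>Y\<close> to \<open>L\<close>.\<close>
  have "L \<subseteq> Y"
  proof
    fix a assume "a \<in> L"
    then have "(**) a ` Y = Y" using \<open>Y \<in> \<M>\<close> by (simp add: L_def)
    moreover have "a ** mat 1 \<in> (**) a ` Y" using Y0(2) Y(2) by blast
    ultimately show "a \<in> Y" by simp
  qed
  then have "irreducible_set L"
    using irreducible_set_cong[of L Y] YK[OF Y(1)] Yirr[OF Y(1)] zL by simp
  then show ?thesis using QL by (auto simp: Q_def)
qed

section \<open>Fields of definition\<close>

lemma single_sum: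
  "Poly_Mapping.single m (sum c I) = (\<Sum>j\<in>I. Poly_Mapping.single m (c j :: 'b::comm_monoid_add))"
  by (induction I rule: infinite_finite_induct) (simp_all add: single_add)

lemma lookup_single_0_times:
  "Poly_Mapping.lookup (Poly_Mapping.single 0 c * p) m = c * Poly_Mapping.lookup (p :: ('v, 'a::comm_ring_1) mpoly) m"
  by (induction p rule: mpoly_induct)
    (simp_all add: distrib_left mult_single lookup_add lookup_single when_def)

lemma module_times: "Modules.module ((*) :: 's::comm_ring_1 \<Rightarrow> 's \<Rightarrow> 's)"
  by unfold_locales (simp_all add: algebra_simps)

lemma subspace_vanishing_ideal: "Modules.module.subspace times (vanishing_ideal V)"
  unfolding Modules.module.subspace_def[OF module_times]
  by (auto simp: vanishing_ideal_def mat_eval_mult mat_eval_def mpoly_eval_add mpoly_eval_mult)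

text \<open>A polynomial vanishing on \<open>V\<close> is a combination \<open>\<Sum> c\<^sub>j f\<^sub>j\<close> with the \<open>f\<^sub>j\<close> over \<open>k\<close>. Once the
  \<open>c\<^sub>j\<close> are linearly independent over \<open>k\<close>, every \<open>f\<^sub>j\<close> vanishes on \<open>V\<close>; otherwise one of them can
  be eliminated.\<close>

lemma sum_in_span_vanishing_ideal:
  fixes V :: "('a::field^'n^'n) set"
  assumes "finite J" and k: "subring_set k" "\<And>a. a \<in> k \<Longrightarrow> inverse a \<in> k"
    and V: "\<And>A i j. A \<in> V \<Longrightarrow> A $ i $ j \<in> k"
    and f: "\<And>j. j \<in> J \<Longrightarrow> f j \<in> polys_over k"
    and van: "(\<Sum>j\<in>J. Poly_Mapping.single 0 (c j) * f j) \<in> vanishing_ideal V"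
  shows "(\<Sum>j\<in>J. Poly_Mapping.single 0 (c j) * f j) \<in>
    module.span times (vanishing_ideal V \<inter> polys_over k)"
  using assms(1) f van
proof (induction "card J" arbitrary: J f rule: less_induct)
  case less
  interpret M: Modules.module "(*) :: ('n \<times> 'n, 'a) mpoly \<Rightarrow> ('n \<times> 'n, 'a) mpoly \<Rightarrow> ('n \<times> 'n, 'a) mpoly"
    by (rule module_times)
  interpret k: subring_set k by (rule k)
  have eval_k: "mat_eval A p \<in> k" if "A \<in> V" "p \<in> polys_over k" for A p
    using that unfolding mat_eval_def mpoly_eval_def polys_over_def
    by (auto intro!: k.sum_mem k.mult_mem k.prod_mem k.power_mem V simp: case_prod_unfold)
  have eval_sum: "mat_eval A (\<Sum>j\<in>I. Poly_Mapping.single 0 (c j) * f j) = (\<Sum>j\<in>I. c j * mat_eval A (f j))"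
    if "finite I" for A I and f :: "_ \<Rightarrow> ('n \<times> 'n, 'a) mpoly"
    using that by (induction I rule: finite_induct)
      (simp_all add: mat_eval_def mpoly_eval_add mpoly_eval_mult mpoly_eval_single)
  show ?case
  proof (cases "\<forall>j\<in>J. f j \<in> vanishing_ideal V")
    case True
    then show ?thesis
      using less.prems(2) by (intro M.span_sum M.span_scale M.span_base) auto
  next
    case False
    then obtain r A where r: "r \<in> J" and A: "A \<in> V" "mat_eval A (f r) \<noteq> 0"
      by (auto simp: vanishing_ideal_def)
    \<comment> \<open>The entries of \<open>A\<close> and the coefficients of the \<open>f j\<close>
      lie in \<open>k\<close>, so evaluation at \<open>A\<close> gives a linear relation over
      \<open>k\<close> between the \<open>c j\<close>. The \<open>l j\<close> come from solving it
      for \<open>c r\<close>.\<close>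
    define l where "l j = - mat_eval A (f j) / mat_eval A (f r)" for j
    have l: "l j \<in> k" if "j \<in> J" for j
      unfolding l_def divide_inverse
      by (rule k.mult_mem[OF k.uminus_mem k(2)]) (use that r A(1) less.prems(2) eval_k in auto)
    let ?J = "J - {r}"
    have "(\<Sum>j\<in>J. c j * mat_eval A (f j)) = 0"
      using less.prems(3) A(1) eval_sum[OF less.prems(1), of A f] by (simp add: vanishing_ideal_def)
    then have "c r * mat_eval A (f r) = - (\<Sum>j\<in>?J. c j * mat_eval A (f j))"
      using sum.remove[OF less.prems(1) r, of "\<lambda>j. c j * mat_eval A (f j)"]
      by (simp add: eq_neg_iff_add_eq_0)
    then have cr: "c r = (\<Sum>j\<in>?J. c j * l j)"
      using A(2) by (simp add: l_def field_simps sum_negf flip: sum_divide_distrib)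
    \<comment> \<open>Substituting for \<open>c r\<close> and regrouping removes the index
      \<open>r\<close> without changing the sum, and the new polynomials are still over
      \<open>k\<close>.\<close>
    let ?f = "\<lambda>j. f j + Poly_Mapping.single 0 (l j) * f r"
    have cl: "Poly_Mapping.single 0 (\<Sum>j\<in>?J. c j * l j) =
        (\<Sum>j\<in>?J. Poly_Mapping.single 0 (c j) * Poly_Mapping.single 0 (l j) :: ('n \<times> 'n, 'a) mpoly)"
      unfolding mult_single add_0 by (rule single_sum)
    have eq: "(\<Sum>j\<in>J. Poly_Mapping.single 0 (c j) * f j) =
        (\<Sum>j\<in>?J. Poly_Mapping.single 0 (c j) * ?f j)"
    proof -
      have "(\<Sum>j\<in>?J. Poly_Mapping.single 0 (c j) * ?f j) =
          (\<Sum>j\<in>?J. Poly_Mapping.single 0 (c j) * f j) + Poly_Mapping.single 0 (c r) * f r"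
        unfolding cr cl by (simp only: distrib_left sum.distrib sum_distrib_right mult.assoc)
      then show ?thesis
        using sum.remove[OF less.prems(1) r, of "\<lambda>j. Poly_Mapping.single 0 (c j) * f j"]
        by (simp only: add.commute)
    qed
    have "?f j \<in> polys_over k" if "j \<in> ?J" for j
    proof -
      have "Poly_Mapping.lookup (Poly_Mapping.single 0 (l j) * f r) m = l j * Poly_Mapping.lookup (f r) m" for m
        by (rule lookup_single_0_times)
      then show ?thesis using that less.prems(2) r l
        by (auto simp: polys_over_def lookup_add intro!: k.add_mem k.mult_mem)
    qed
    moreover have "card ?J < card J" using less.prems(1) r by (intro psubset_card_mono) auto
    ultimately show ?thesis
      using less.hyps[of ?J ?f] less.prems(1,3) unfolding eq by simp
  qed
qed

text \<open>\<open>V\<close> and \<open>W\<close> have the same vanishing ideal. A member of it is a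
  combination of monomials, which are over \<open>k\<close>, with its own coefficients as the
  \<open>c j\<close> of the previous lemma. Density of points with entries in \<open>k\<close> takes
  the place of Galois descent.\<close>

lemma defined_over_closure:
  fixes V W :: "('a::field^'n^'n) set"
  assumes k: "subring_set k" "\<And>a. a \<in> k \<Longrightarrow> inverse a \<in> k"
    and V: "\<And>A i j. A \<in> V \<Longrightarrow> A $ i $ j \<in> k" and W: "V \<subseteq> W" "W \<subseteq> zcl V"
  shows "defined_over k W"
proof -
  interpret M: Modules.module "(*) :: ('n \<times> 'n, 'a) mpoly \<Rightarrow> ('n \<times> 'n, 'a) mpoly \<Rightarrow> ('n \<times> 'n, 'a) mpoly"
    by (rule module_times)
  interpret k: subring_set k by (rule k)
  have VW: "vanishing_ideal W = vanishing_ideal V"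
    using W by (auto simp: vanishing_ideal_def zcl_eq_zero_locus zero_locus_def subset_iff)
  have "p \<in> M.span (vanishing_ideal V \<inter> polys_over k)" if p: "p \<in> vanishing_ideal V" for p
  proof -
    let ?S = "\<Sum>m\<in>Poly_Mapping.keys p. Poly_Mapping.single 0 (Poly_Mapping.lookup p m) * Poly_Mapping.single m 1"
    have "p = ?S"
      by (rule poly_mapping_eqI)
        (simp add: mult_single lookup_sum lookup_single when_def in_keys_iff)
    moreover have "Poly_Mapping.single m 1 \<in> polys_over k" for m :: "('n \<times> 'n) \<Rightarrow>\<^sub>0 nat"
      by (auto simp: polys_over_def lookup_single when_def k.one_mem k.zero_mem)
    ultimately show ?thesis
      using sum_in_span_vanishing_ideal[OF finite_keys[of p] k V, where V = V
          and f = "\<lambda>m. Poly_Mapping.single m 1" and c = "Poly_Mapping.lookup p"] p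
      by (metis (no_types, lifting))
  qed
  moreover have "M.span (vanishing_ideal V \<inter> polys_over k) \<subseteq> vanishing_ideal V"
    by (intro M.span_minimal subspace_vanishing_ideal) simp
  ultimately show ?thesis unfolding defined_over_def VW by blast
qed

lemma subfield_type_algebra:
  assumes "subfield k (ring_of_type_algebra :: 'a::field ring)"
  shows "subring_set k" "a \<in> k \<Longrightarrow> inverse a \<in> k"
proof -
  let ?R = "ring_of_type_algebra :: 'a ring"
  interpret subfield k ?R by (rule assms)
  interpret R: Ring.field ?R by (rule field_from_type_algebra)
  have neg: "\<ominus>\<^bsub>?R\<^esub> a = - a" for a
    by (rule R.minus_equality) (simp_all add: ring_of_type_algebra_def)
  show "subring_set k"
  proof
    show "1 \<in> k" using one_closed by (simp add: ring_of_type_algebra_def)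
    fix a b assume ab: "a \<in> k" "b \<in> k"
    show "a * b \<in> k" using m_closed[OF ab] by (simp add: ring_of_type_algebra_def)
    have "- b \<in> k" using subringE(5)[OF subring_axioms ab(2)] neg by simp
    from subringE(7)[OF subring_axioms ab(1) this] show "a - b \<in> k" by (simp add: ring_of_type_algebra_def)
  qed
  assume a: "a \<in> k"
  show "inverse a \<in> k"
  proof (cases "a = 0")
    case False
    then have "a \<in> Units (?R\<lparr>carrier := k\<rparr>)"
      using a unfolding subfield_Units by (simp add: ring_of_type_algebra_def)
    then obtain b where "b \<in> k" "a * b = 1"
      by (auto simp: Units_def ring_of_type_algebra_def)
    then show ?thesis by (metis inverse_unique)
  qed (use a in simp)
qed

section \<open>Products of commuting groups\<close>

lemma det_in_fun_alg:
  fixes h :: "'x \<Rightarrow> 'a::field^'n^'n"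
  assumes "\<And>i j. (\<lambda>y. h y $ i $ j) \<in> fun_alg F"
  shows "(\<lambda>y. det (h y)) \<in> fun_alg F"
proof -
  have "(\<Sum>p | p permutes UNIV. (\<lambda>_. of_int (sign p)) * (\<Prod>i\<in>UNIV. (\<lambda>y. h y $ i $ p i))) \<in> fun_alg F"
    by (intro fun_alg.sum_mem fun_alg.mult fun_alg.prod_mem assms) (rule fun_alg.const)
  moreover have "(\<Sum>p | p permutes UNIV. (\<lambda>_. of_int (sign p)) * (\<Prod>i\<in>UNIV. (\<lambda>y. h y $ i $ p i))) =
      (\<lambda>y. det (h y))"
    by (rule ext) (simp add: det_def sum_fun_apply prod_fun_apply)
  ultimately show ?thesis by simp
qed

lemma subgroup_commuting_product:
  fixes A B :: "('a::field^'n^'n) set"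
  assumes A: "subgroup A GL" and B: "subgroup B GL"
    and comm: "\<And>a b. a \<in> A \<Longrightarrow> b \<in> B \<Longrightarrow> a ** b = b ** a"
  shows "subgroup ((\<lambda>(a, b). a ** b) ` (A \<times> B)) GL"
  unfolding subgroup_GL_iff
proof (intro conjI ballI)
  let ?P = "(\<lambda>(a, b). a ** b) ` (A \<times> B)"
  have A': "mat 1 \<in> A" "\<And>a b. a \<in> A \<Longrightarrow> b \<in> A \<Longrightarrow> a ** b \<in> A"
    and B': "mat 1 \<in> B" "\<And>a b. a \<in> B \<Longrightarrow> b \<in> B \<Longrightarrow> a ** b \<in> B"
    using A B by (auto simp: subgroup_GL_iff)
  show "mat 1 \<in> ?P" using A'(1) B'(1) by (intro image_eqI[of _ _ "(mat 1, mat 1)"]) auto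
  fix x assume "x \<in> ?P"
  then obtain a b where ab: "a \<in> A" "b \<in> B" "x = a ** b" by auto
  have prod: "(a ** b) ** (c ** d) = (a ** c) ** (b ** d)" if "b \<in> B" "c \<in> A" for a b c d
    using comm[OF that(2,1)] by (metis matrix_mul_assoc)
  show "x ** y \<in> ?P" if "y \<in> ?P" for y
  proof -
    obtain c d where "c \<in> A" "d \<in> B" "y = c ** d" using \<open>y \<in> ?P\<close> by auto
    then have "x ** y = (a ** c) ** (b ** d)" "a ** c \<in> A" "b ** d \<in> B"
      using ab prod A'(2) B'(2) by auto
    then show ?thesis by auto
  qed
  obtain a' where a': "a' \<in> A" "a ** a' = mat 1" "a' ** a = mat 1"
    using subgroup_GL_inverse[OF A ab(1)] by blast
  obtain b' where b': "b' \<in> B" "b ** b' = mat 1" "b' ** b = mat 1"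
    using subgroup_GL_inverse[OF B ab(2)] by blast
  have "x ** (a' ** b') = mat 1"
    unfolding ab(3) prod[OF ab(2) a'(1)] a'(2) b'(2) by simp
  moreover have "(a' ** b') ** x = mat 1"
    unfolding ab(3) prod[OF b'(1) ab(1)] a'(3) b'(3) by simp
  moreover have "a' ** b' \<in> ?P" using a'(1) b'(1) by auto
  ultimately show "\<exists>y\<in>?P. x ** y = mat 1 \<and> y ** x = mat 1" by blast
qed

section \<open>Triples of matrices and the closedness of a commuting product\<close>

type_synonym 'n triple_index = "('n \<times> 'n) + ('n \<times> 'n) + ('n \<times> 'n)"

text \<open>Triples are encoded as functions on one index type so that their entries can be
  eliminated like coordinates.\<close>

definition triple :: "'a^'n^'n \<Rightarrow> 'a^'n^'n \<Rightarrow> 'a^'n^'n \<Rightarrow> 'n triple_index \<Rightarrow> 'a" where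
  "triple a b c v = (case v of Inl (i, j) \<Rightarrow> a $ i $ j | Inr (Inl (i, j)) \<Rightarrow> b $ i $ j
     | Inr (Inr (i, j)) \<Rightarrow> c $ i $ j)"

lemma triple_simps [simp]:
  "triple a b c (Inl (i, j)) = a $ i $ j"
  "triple a b c (Inr (Inl (i, j))) = b $ i $ j"
  "triple a b c (Inr (Inr (i, j))) = c $ i $ j"
  by (simp_all add: triple_def)

lemma triple_surj: "\<exists>a b c. x = triple a b c"
  by (intro exI[of _ "\<chi> i j. x (Inl (i, j))"] exI[of _ "\<chi> i j. x (Inr (Inl (i, j)))"]
      exI[of _ "\<chi> i j. x (Inr (Inr (i, j)))"]) (auto simp: triple_def fun_eq_iff split: sum.split)

lemma coord_alg_triple:
  fixes a b c :: "'x \<Rightarrow> 'a::field^'n^'n"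
  assumes "f \<in> coord_alg U"
    and "\<And>i j. (\<lambda>y. a y $ i $ j) \<in> fun_alg F" "\<And>i j. (\<lambda>y. b y $ i $ j) \<in> fun_alg F"
      "\<And>i j. (\<lambda>y. c y $ i $ j) \<in> fun_alg F"
  shows "(\<lambda>y. f (triple (a y) (b y) (c y))) \<in> fun_alg F"
  using assms(1) unfolding coord_alg_def
proof (rule fun_alg_comp)
  fix g :: "('n triple_index \<Rightarrow> 'a) \<Rightarrow> 'a" assume "g \<in> (\<lambda>v x. x v) ` U"
  then obtain v where g: "g = (\<lambda>x. x v)" by blast
  show "(\<lambda>y. g (triple (a y) (b y) (c y))) \<in> fun_alg F"
  proof (cases v)
    case (Inl p)
    then show ?thesis using assms(2) by (cases p) (simp add: g)
  next
    case (Inr w)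
    then show ?thesis using assms(3,4) by (cases w; cases "projl w"; cases "projr w") (auto simp: g)
  qed
qed


lemma closed_product:
  fixes A B :: "('a::{alg_closed_field, field_char_0}^'n^'n) set"
  assumes A: "subgroup A GL" "irreducible_set A" and B: "subgroup B GL" "irreducible_set B"
    and comm: "\<And>a b. a \<in> A \<Longrightarrow> b \<in> B \<Longrightarrow> a ** b = b ** a"
  shows "zcl ((\<lambda>(a, b). a ** b) ` (A \<times> B)) \<inter> carrier GL \<subseteq>
    (\<lambda>(a, b). a ** b) ` ((zcl A \<inter> carrier GL) \<times> (zcl B \<inter> carrier GL))"
proof
  let ?P = "(\<lambda>(a, b). a ** b) ` (A \<times> B)"
  let ?Q = "(\<lambda>(a, b). a ** b) ` ((zcl A \<inter> carrier GL) \<times> (zcl B \<inter> carrier GL))"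
  define Z where "Z = (\<lambda>(a, b). triple a b (a ** b)) ` (A \<times> B)"
  \<comment> \<open>The entries of the product are kept, those of the two factors are
    eliminated.\<close>
  define U :: "'n triple_index set" where "U = range (\<lambda>p. Inr (Inr p))"
  define W :: "'n triple_index set" where "W = - U"
  have one: "mat 1 \<in> A" "mat 1 \<in> B" using A(1) B(1) by (auto simp: subgroup_GL_iff)
  have vanZ: "vanishes_on Z f \<longleftrightarrow> (\<forall>a\<in>A. \<forall>b\<in>B. f (triple a b (a ** b)) = 0)"
    for f :: "('n triple_index \<Rightarrow> 'a) \<Rightarrow> 'a"
    by (auto simp: vanishes_on_def Z_def)
  have fixA: "(\<lambda>b. f (triple a b (a ** b))) \<in> mat_alg"
    and fixB: "(\<lambda>a. f (triple a b (a ** b))) \<in> mat_alg" if "f \<in> coord_alg UNIV" for f a b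
    unfolding mat_alg_def
    by (rule coord_alg_triple[OF that]; (rule fun_alg.const)?;
        (rule matrix_mult_entry_in_fun_alg)?; (rule fun_alg.const)?;
        (rule entry_in_mat_alg[unfolded mat_alg_def])?)+
  \<comment> \<open>A product of irreducible sets is irreducible: for fixed \<open>a\<close>,
    irreducibility of \<open>B\<close> decides which of \<open>f\<close> and \<open>g\<close>
    vanishes for all \<open>b\<close>. The two resulting closed conditions on \<open>a\<close> cover
    \<open>A\<close>, whose irreducibility selects one.\<close>
  interpret integral_set Z
  proof
    fix f g assume f: "f \<in> coord_alg UNIV" and g: "g \<in> coord_alg UNIV" and van: "vanishes_on Z (f * g)"
    define C where "C h = {a. \<forall>k\<in>(\<lambda>b a. h (triple a b (a ** b))) ` B. k a = 0}"
      for h :: "('n triple_index \<Rightarrow> 'a) \<Rightarrow> 'a"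
    have closed: "closedin zariski (C h)" if "h \<in> coord_alg UNIV" for h
      unfolding C_def by (rule closedin_vanishing) (use fixB[OF that] in blast)
    have "A \<subseteq> C f \<union> C g"
    proof
      fix a assume a: "a \<in> A"
      have "vanishes_on B ((\<lambda>b. f (triple a b (a ** b))) * (\<lambda>b. g (triple a b (a ** b))))"
        using van a unfolding vanZ by (simp add: vanishes_on_def)
      then have "vanishes_on B (\<lambda>b. f (triple a b (a ** b))) \<or> vanishes_on B (\<lambda>b. g (triple a b (a ** b)))"
        using B(2) fixA[OF f] fixA[OF g] unfolding irreducible_set_def by blast
      then show "a \<in> C f \<union> C g" by (auto simp: C_def vanishes_on_def)
    qed
    then have "A \<subseteq> C f \<or> A \<subseteq> C g"
      by (intro irreducible_set_subset_Un A(2) closed f g)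
    then show "vanishes_on Z f \<or> vanishes_on Z g"
      unfolding vanZ by (auto simp: C_def)
  qed
  let ?a = "\<lambda>x :: 'n triple_index \<Rightarrow> 'a. (\<chi> i j. x (Inl (i, j))) :: 'a^'n^'n"
    and ?b = "\<lambda>x :: 'n triple_index \<Rightarrow> 'a. (\<chi> i j. x (Inr (Inl (i, j)))) :: 'a^'n^'n"
  have entries: "(\<lambda>x. ?a x $ i $ j) \<in> coord_alg UNIV" "(\<lambda>x. ?b x $ i $ j) \<in> coord_alg UNIV" for i j
    unfolding coord_alg_def by (auto intro: fun_alg.gen)
  \<comment> \<open>Its nonvanishing keeps the recovered factors invertible; at the pair of
    identities its value is 1.\<close>
  define s where "s = (\<lambda>x. det (?a x)) * (\<lambda>x. det (?b x))"
  have s_triple: "s (triple a b c) = det a * det b" for a b c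
    by (simp add: s_def)
  have "s \<in> coord_alg UNIV"
    unfolding s_def coord_alg_def
    by (intro fun_alg.mult det_in_fun_alg) (use entries in \<open>simp_all add: coord_alg_def\<close>)
  moreover have "\<not> vanishes_on Z s"
    unfolding vanZ s_triple using one by (metis det_I mult_1 zero_neq_one)
  moreover have "finite W" "U \<inter> W = {}" "U \<union> W = UNIV" by (auto simp: W_def)
  ultimately obtain r where r: "r \<in> coord_alg U" "\<not> vanishes_on Z r"
    and ext: "\<And>y. closure_point Z U y \<Longrightarrow> r y \<noteq> 0 \<Longrightarrow>
      \<exists>z. (\<forall>v. v \<notin> W \<longrightarrow> z v = y v) \<and> closure_point Z UNIV z \<and> s z \<noteq> 0"
    using extend_coordinates[of W U s] by metis
  \<comment> \<open>Functions of the coordinates in \<open>U\<close> see only the third matrix, so 0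
    can stand for the other two.\<close>
  have onU: "f (triple a b c) = f (triple 0 0 c)" if "f \<in> coord_alg U" for f a b c
    by (rule coord_alg_cong[OF that]) (auto simp: U_def)
  define r' where "r' c = r (triple 0 0 c)" for c
  have third: "(\<lambda>c. f (triple 0 0 c)) \<in> mat_alg" if "f \<in> coord_alg U" for f
    unfolding mat_alg_def
    by (rule coord_alg_triple[OF that]; (rule fun_alg.const)?; (rule entry_in_mat_alg[unfolded mat_alg_def])?)
  have r'_alg: "r' \<in> mat_alg" unfolding r'_def[abs_def] by (rule third[OF r(1)])
  obtain a0 b0 where ab0: "a0 \<in> A" "b0 \<in> B" "r (triple a0 b0 (a0 ** b0)) \<noteq> 0"
    using r(2) unfolding vanZ by blast
  then obtain h where h: "h \<in> ?P" "r' h \<noteq> 0"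
    unfolding onU[OF r(1), of a0] r'_def by blast
  have generic: "g \<in> ?Q" if g: "g \<in> zcl ?P" "r' g \<noteq> 0" for g
  proof -
    have "closure_point Z U (triple 0 0 g)"
      unfolding closure_point_def
    proof (intro ballI impI)
      fix f assume f: "f \<in> coord_alg U" "vanishes_on Z f"
      have "f (triple 0 0 (a ** b)) = 0" if "a \<in> A" "b \<in> B" for a b
        using f(2) that onU[OF f(1), of a b "a ** b"] unfolding vanZ by metis
      then have "vanishes_on ?P (\<lambda>c. f (triple 0 0 c))" by (auto simp: vanishes_on_def)
      then show "f (triple 0 0 g) = 0" using vanishes_on_zcl[OF third[OF f(1)] _ g(1)] by blast
    qed
    then obtain z where z: "\<forall>v. v \<notin> W \<longrightarrow> z v = triple 0 0 g v" "closure_point Z UNIV z" "s z \<noteq> 0"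
      using ext g(2) unfolding r'_def by blast
    obtain a b c where abc: "z = triple a b c" using triple_surj by blast
    have "z (Inr (Inr (i, j))) = g $ i $ j" for i j
      using z(1) by (simp add: W_def U_def)
    then have cg: "c = g" unfolding abc by (simp add: vec_eq_iff)
    \<comment> \<open>Polynomial identities valid on all triples \<open>(a, b, a ** b)\<close> hold
      at \<open>z\<close>. Three families of them follow: equations of \<open>A\<close>, equations
      of \<open>B\<close>, and the entries of the product.\<close>
    have z0: "f z = 0" if "f \<in> coord_alg UNIV" "\<And>a b. a \<in> A \<Longrightarrow> b \<in> B \<Longrightarrow> f (triple a b (a ** b)) = 0" for f
      using z(2) that unfolding closure_point_def vanZ by blast
    have "a \<in> zcl A"
      unfolding in_zcl_iff
    proof (intro ballI impI)
      fix f :: "'a^'n^'n \<Rightarrow> 'a" assume f: "f \<in> mat_alg" "vanishes_on A f"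
      have "(\<lambda>x. f (?a x)) \<in> coord_alg UNIV"
        unfolding coord_alg_def by (rule mat_alg_comp[OF f(1)]) (rule entries[unfolded coord_alg_def])
      from z0[OF this] show "f a = 0" using f(2) by (simp add: abc vanishes_on_def)
    qed
    moreover have "b \<in> zcl B"
      unfolding in_zcl_iff
    proof (intro ballI impI)
      fix f :: "'a^'n^'n \<Rightarrow> 'a" assume f: "f \<in> mat_alg" "vanishes_on B f"
      have "(\<lambda>x. f (?b x)) \<in> coord_alg UNIV"
        unfolding coord_alg_def by (rule mat_alg_comp[OF f(1)]) (rule entries[unfolded coord_alg_def])
      from z0[OF this] show "f b = 0" using f(2) by (simp add: abc vanishes_on_def)
    qed
    moreover have "g = a ** b"
    proof -
      have "(\<lambda>x. x (Inr (Inr (i, j)))) - (\<lambda>x. (?a x ** ?b x) $ i $ j) \<in> coord_alg UNIV" for i j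
        unfolding coord_alg_def
        by (intro fun_alg.diff_mem matrix_mult_entry_in_fun_alg entries[unfolded coord_alg_def])
          (rule fun_alg.gen, blast)
      from z0[OF this] have "g $ i $ j = (a ** b) $ i $ j" for i j
        by (simp add: abc cg)
      then show ?thesis by (simp add: vec_eq_iff)
    qed
    moreover have "det a \<noteq> 0" "det b \<noteq> 0" using z(3) by (auto simp: abc s_triple)
    ultimately show ?thesis
      by (auto simp: carrier_GL invertible_det_nz)
  qed
  have P: "subgroup ?P GL" by (rule subgroup_commuting_product[OF A(1) B(1) comm])
  have Q: "subgroup ?Q GL"
    by (rule subgroup_commuting_product[OF subgroup_GL_zcl[OF A(1)] subgroup_GL_zcl[OF B(1)]])
      (use zcl_commute[of A B] comm in blast)
  have PQ: "?P \<subseteq> ?Q"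
    using subset_zcl[of A] subset_zcl[of B] subgroup.subset[OF A(1)] subgroup.subset[OF B(1)] by blast
  fix g assume g: "g \<in> zcl ?P \<inter> carrier GL"
  have D: "subgroup (zcl ?P \<inter> carrier GL) GL" by (rule subgroup_GL_zcl[OF P])
  then have Dmult: "x ** y \<in> zcl ?P" if "x \<in> zcl ?P \<inter> carrier GL" "y \<in> zcl ?P \<inter> carrier GL" for x y
    using that unfolding subgroup_GL_iff by blast
  have PD: "?P \<subseteq> zcl ?P \<inter> carrier GL" using subset_zcl[of ?P] subgroup.subset[OF P] by blast
  obtain g' where g': "g' \<in> zcl ?P \<inter> carrier GL" "g ** g' = mat 1"
    using subgroup_GL_inverse[OF D g] by blast
  \<comment> \<open>Otherwise the function \<open>r'\<close> of \<open>g ** x\<close> would vanish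
    for every \<open>x\<close> in the closure, including \<open>x = g' ** h\<close>, for which
    \<open>g ** x = h\<close>.\<close>
  have "\<exists>x\<in>?P. r' (g ** x) \<noteq> 0"
  proof (rule ccontr)
    assume "\<not> (\<exists>x\<in>?P. r' (g ** x) \<noteq> 0)"
    then have "vanishes_on ?P (\<lambda>x. r' (g ** x))" unfolding vanishes_on_def by blast
    moreover have "g' ** h \<in> zcl ?P" using Dmult[OF g'(1)] h(1) PD by blast
    ultimately have "r' (g ** (g' ** h)) = 0"
      by (rule vanishes_on_zcl[OF mat_alg_mult_left[OF r'_alg]])
    then show False using h(2) cancel_inverse[OF g'(2), of h] by simp
  qed
  then obtain x where x: "x \<in> ?P" "r' (g ** x) \<noteq> 0" by blast
  then have "g ** x \<in> ?Q" using generic Dmult[OF g] PD by blast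
  obtain x' where x': "x' \<in> ?P" "x ** x' = mat 1" using subgroup_GL_inverse[OF P x(1)] by blast
  have "(g ** x) ** x' \<in> ?Q"
    using Q \<open>g ** x \<in> ?Q\<close> x'(1) PQ unfolding subgroup_GL_iff by blast
  moreover have "(g ** x) ** x' = g" using x'(2) by (simp flip: matrix_mul_assoc)
  ultimately show "g \<in> ?Q" by simp
qed

section \<open>Cosets and density\<close>

lemma finite_index_commuting_product:
  fixes A B :: "('a::field^'n^'n) set"
  assumes "finite_index A' A" "finite_index B' B" "A' \<subseteq> A"
    and comm: "\<And>a b. a \<in> A \<Longrightarrow> b \<in> B \<Longrightarrow> a ** b = b ** a"
  shows "finite_index ((\<lambda>(a, b). a ** b) ` (A' \<times> B')) ((\<lambda>(a, b). a ** b) ` (A \<times> B))"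
proof -
  obtain S T where S: "finite S" "S \<subseteq> A" "A \<subseteq> (\<Union>s\<in>S. (**) s ` A')"
    and T: "finite T" "T \<subseteq> B" "B \<subseteq> (\<Union>t\<in>T. (**) t ` B')"
    using assms(1,2) by (auto simp: finite_index_def)
  show ?thesis unfolding finite_index_def
  proof (intro exI[of _ "(\<lambda>(s, t). s ** t) ` (S \<times> T)"] conjI subsetI)
    show "finite ((\<lambda>(s, t). s ** t) ` (S \<times> T))" using S T by simp
    show "x \<in> (\<lambda>(a, b). a ** b) ` (A \<times> B)" if "x \<in> (\<lambda>(s, t). s ** t) ` (S \<times> T)" for x
      using that S(2) T(2) by auto
    fix x assume "x \<in> (\<lambda>(a, b). a ** b) ` (A \<times> B)"
    then obtain a b where ab: "a \<in> A" "b \<in> B" "x = a ** b" by auto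
    obtain s a' where s: "s \<in> S" "a' \<in> A'" "a = s ** a'" using S(3) ab(1) by blast
    obtain t b' where t: "t \<in> T" "b' \<in> B'" "b = t ** b'" using T(3) ab(2) by blast
    have "a' ** t = t ** a'" using comm s(2) t(1) assms(3) T(2) by blast
    then have "x = (s ** t) ** (a' ** b')"
      unfolding ab(3) s(3) t(3) by (metis matrix_mul_assoc)
    then show "x \<in> (\<Union>u\<in>(\<lambda>(s, t). s ** t) ` (S \<times> T). (**) u ` (\<lambda>(a, b). a ** b) ` (A' \<times> B'))"
      using s(1,2) t(1,2) by blast
  qed
qed

text \<open>Inside \<open>GL\<close> the closures of the cosets \<open>P ** u\<close> are cosets of
  the group \<open>?D\<close>, hence equal to \<open>?D\<close> or disjoint from it. They split
  \<open>G\<close> into two disjoint relatively closed parts, and the one in \<open>zcl P\<close>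
  contains the identity.\<close>

lemma connected_subset_zcl:
  fixes P G :: "('a::field^'n^'n) set"
  assumes G: "connectedin zariski G" "G \<subseteq> carrier GL" "mat 1 \<in> G"
    and P: "subgroup P GL" and T: "finite T" "T \<subseteq> carrier GL"
    and dense: "G \<subseteq> zcl (\<Union>u\<in>T. (\<lambda>p. p ** u) ` P)"
  shows "G \<subseteq> zcl P"
proof -
  let ?D = "zcl P \<inter> carrier GL"
  have D: "subgroup ?D GL" by (rule subgroup_GL_zcl[OF P])
  have Dmult: "x ** y \<in> ?D" if "x \<in> ?D" "y \<in> ?D" for x y
    using D that unfolding subgroup_GL_iff by blast
  have PD: "P \<subseteq> ?D" using subset_zcl[of P] subgroup.subset[OF P] by blast
  \<comment> \<open>For \<open>u\<close> in \<open>?D\<close> the coset already lies in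
    \<open>zcl P\<close>, so only the remaining ones are collected.\<close>
  define E where "E = (\<Union>u\<in>T - ?D. zcl ((\<lambda>p. p ** u) ` P))"
  have E: "closedin zariski E" unfolding E_def using T(1) by (intro closedin_Union) auto
  have "(\<Union>u\<in>T. (\<lambda>p. p ** u) ` P) \<subseteq> zcl P \<union> E"
  proof clarify
    fix u p assume up: "u \<in> T" "p \<in> P" "p ** u \<notin> E"
    have "u \<in> ?D"
    proof (rule ccontr)
      assume "u \<notin> ?D"
      then have "p ** u \<in> E" unfolding E_def using up subset_zcl[of "(\<lambda>p. p ** u) ` P"] by blast
      then show False using up(3) by simp
    qed
    then show "p ** u \<in> zcl P" using Dmult PD up(2) by blast
  qed
  then have cover: "G \<subseteq> zcl P \<union> E"
    by (rule order_trans[OF dense zcl_minimal]) (intro closedin_Un closedin_closure_of E)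
  \<comment> \<open>For a common point \<open>g\<close>, the element \<open>g ** u'\<close> lies in
    \<open>?D\<close>; then so does \<open>u\<close>, as the inverse of that element times
    \<open>g\<close>.\<close>
  have disj: "g \<notin> E" if g: "g \<in> G" "g \<in> zcl P" for g
  proof
    assume "g \<in> E"
    then obtain u where u: "u \<in> T" "u \<notin> ?D" "g \<in> zcl ((\<lambda>p. p ** u) ` P)" by (auto simp: E_def)
    obtain u' where u': "u ** u' = mat 1" "u' ** u = mat 1"
      using u(1) T(2) by (auto simp: carrier_GL invertible_def subset_iff)
    have "p ** u ** u' = p" for p :: "'a^'n^'n"
      using u'(1) by (simp flip: matrix_mul_assoc)
    then have "(\<lambda>x. x ** u') ` (\<lambda>p. p ** u) ` P \<subseteq> P" by auto
    with u(3) have "g ** u' \<in> zcl P" by (rule zcl_mult_right)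
    moreover have "invertible u'" using u' unfolding invertible_def by blast
    then have "invertible (g ** u')" using g(1) G(2) by (auto simp: carrier_GL invertible_mult subset_iff)
    ultimately have "g ** u' \<in> ?D" by (simp add: carrier_GL)
    then obtain x where x: "x \<in> ?D" "x ** (g ** u') = mat 1" using subgroup_GL_inverse[OF D] by blast
    have "g \<in> ?D" using g G(2) by blast
    have "(x ** (g ** u')) ** u = x ** g"
      using u'(2) by (simp flip: matrix_mul_assoc)
    then have "u = x ** g" using x(2) by simp
    then show False using Dmult[OF x(1) \<open>g \<in> ?D\<close>] u(2) by simp
  qed
  have "mat 1 \<in> zcl P" using D by (simp add: subgroup_GL_iff)
  have "E \<inter> G = {}"
  proof (rule ccontr)
    assume "E \<inter> G \<noteq> {}"
    moreover have "zcl P \<inter> E \<inter> G = {}" using disj by blast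
    moreover have "zcl P \<inter> G \<noteq> {}" using G(3) \<open>mat 1 \<in> zcl P\<close> by blast
    moreover have "closedin zariski (zcl P)" by simp
    ultimately have "\<exists>C E. closedin zariski C \<and> closedin zariski E \<and> G \<subseteq> C \<union> E \<and>
        C \<inter> E \<inter> G = {} \<and> C \<inter> G \<noteq> {} \<and> E \<inter> G \<noteq> {}"
      using cover E by (intro exI[of _ "zcl P"] exI[of _ E] conjI)
    then show False using G(1) unfolding connectedin_closedin by simp
  qed
  then show ?thesis using cover by blast
qed

lemma finite_rcosets_reps:
  fixes P \<Gamma> :: "('a::field^'n^'n) set"
  assumes "finite (rcosets\<^bsub>GL\<lparr>carrier := \<Gamma>\<rparr>\<^esub> P)" "mat 1 \<in> P"
  shows "\<exists>T. finite T \<and> T \<subseteq> \<Gamma> \<and> \<Gamma> \<subseteq> (\<Union>t\<in>T. (\<lambda>p. p ** t) ` P)"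
proof -
  let ?c = "\<lambda>g. (\<lambda>p. p ** g) ` P"
  have "rcosets\<^bsub>GL\<lparr>carrier := \<Gamma>\<rparr>\<^esub> P = ?c ` \<Gamma>"
    by (auto simp: RCOSETS_def r_coset_def image_def)
  then have "finite (?c ` \<Gamma>)" using assms(1) by simp
  then obtain T where T: "T \<subseteq> \<Gamma>" "finite T" "?c ` \<Gamma> = ?c ` T"
    using finite_subset_image[of "?c ` \<Gamma>" ?c \<Gamma>] by auto
  have "g \<in> (\<Union>t\<in>T. ?c t)" if g: "g \<in> \<Gamma>" for g
  proof -
    have "?c g \<in> ?c ` T" using g T(3) by blast
    then obtain t where "t \<in> T" "?c g = ?c t" by blast
    moreover have "g \<in> ?c g" by (rule image_eqI[OF _ assms(2)]) simp
    ultimately show ?thesis by blast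
  qed
  then show ?thesis using T by blast
qed

text \<open>Inversion exchanges the two sides: if the inverse of \<open>x\<close> is
  \<open>s ** p\<close>, then \<open>x\<close> is the inverse of \<open>p\<close> times the inverse
  of \<open>s\<close>. This reconciles \<open>finite_index\<close> with the right cosets counted by
  \<open>rcosets\<close>.\<close>

lemma finite_index_right_reps:
  fixes P H :: "('a::field^'n^'n) set"
  assumes H: "subgroup H GL" and P: "subgroup P GL" and "finite_index P H"
  shows "\<exists>T. finite T \<and> T \<subseteq> H \<and> H \<subseteq> (\<Union>t\<in>T. (\<lambda>p. p ** t) ` P)"
proof -
  obtain S where S: "finite S" "S \<subseteq> H" "H \<subseteq> (\<Union>s\<in>S. (**) s ` P)"
    using assms(3) by (auto simp: finite_index_def)
  obtain i where i: "\<And>s. s \<in> H \<Longrightarrow> i s \<in> H \<and> s ** i s = mat 1 \<and> i s ** s = mat 1"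
    using subgroup_GL_inverse[OF H] by metis
  have "x \<in> (\<Union>t\<in>i ` S. (\<lambda>p. p ** t) ` P)" if x: "x \<in> H" for x
  proof -
    obtain y where y: "y \<in> H" "x ** y = mat 1" "y ** x = mat 1" using subgroup_GL_inverse[OF H x] by blast
    obtain s p where s: "s \<in> S" "p \<in> P" "y = s ** p" using S(3) y(1) by blast
    obtain q where q: "q \<in> P" "q ** p = mat 1" "p ** q = mat 1" using subgroup_GL_inverse[OF P s(2)] by blast
    have inv: "s ** i s = mat 1" using i s(1) S(2) by blast
    have "y ** (q ** i s) = s ** (p ** q) ** i s"
      unfolding s(3) by (simp add: matrix_mul_assoc)
    then have "y ** (q ** i s) = mat 1" using inv q(3) by simp
    then have "x = q ** i s" using cancel_inverse[OF y(2), of "q ** i s"] by simp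
    then show ?thesis using q(1) s(1) by blast
  qed
  then show ?thesis using S i by (intro exI[of _ "i ` S"]) auto
qed

lemma linear_algebraic_group_zcl:
  fixes H :: "('a::field^'n^'n) set"
  assumes k: "subfield k (ring_of_type_algebra :: 'a ring)"
    and H: "subgroup H GL" "\<And>A i j. A \<in> H \<Longrightarrow> A $ i $ j \<in> k"
  shows "linear_algebraic_group k (zcl H \<inter> carrier GL)"
  unfolding linear_algebraic_group_def
proof (intro conjI subgroup_GL_zcl[OF H(1)])
  show "closedin (subtopology zariski (carrier GL)) (zcl H \<inter> carrier GL)"
    unfolding closedin_subtopology by (intro exI[of _ "zcl H"]) simp
  show "defined_over k (zcl H \<inter> carrier GL)"
    by (rule defined_over_closure[OF subfield_type_algebra[OF k], where V = H])
      (use H subset_zcl subgroup.subset[OF H(1)] in blast)+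
qed

theorem theorem5p3:
  fixes k :: "'a::{alg_closed_field, field_char_0} set"
    and G \<Gamma> :: "('a^'n^'n) set"
  assumes "subfield k ring_of_type_algebra"
    and "linear_algebraic_group k G"
    and "zariski_dim G > 0"
    and "connectedin zariski G"
    and "\<not> alg_presentable_by_product k G"
    and "subgroup \<Gamma> (GL\<lparr>carrier := k_points k G\<rparr>)"
    and "zariski_dense \<Gamma> G"
  shows "\<not> presentable_by_product TYPE('b) TYPE('c) (GL\<lparr>carrier := \<Gamma>\<rparr>)"
proof
  assume "presentable_by_product TYPE('b) TYPE('c) (GL\<lparr>carrier := \<Gamma>\<rparr>)"
  then obtain \<Gamma>1 :: "'b monoid" and \<Gamma>2 :: "'c monoid" and \<phi> where
    gr: "group \<Gamma>1" "group \<Gamma>2" and hom: "\<phi> \<in> hom (\<Gamma>1 \<times>\<times> \<Gamma>2) (GL\<lparr>carrier := \<Gamma>\<rparr>)"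
    and inf: "infinite (\<phi> ` (carrier \<Gamma>1 \<times> {\<one>\<^bsub>\<Gamma>2\<^esub>}))" "infinite (\<phi> ` ({\<one>\<^bsub>\<Gamma>1\<^esub>} \<times> carrier \<Gamma>2))"
    and fin: "finite (rcosets\<^bsub>GL\<lparr>carrier := \<Gamma>\<rparr>\<^esub> (\<phi> ` carrier (\<Gamma>1 \<times>\<times> \<Gamma>2)))"
    unfolding presentable_by_product_def by blast
  interpret g1: group \<Gamma>1 by (rule gr)
  interpret g2: group \<Gamma>2 by (rule gr)
  have G: "subgroup G GL" "closedin (subtopology zariski (carrier GL)) G"
    using assms(2) by (auto simp: linear_algebraic_group_def)
  have GGL: "G \<subseteq> carrier GL" by (rule subgroup.subset[OF G(1)])
  have \<Gamma>k: "\<Gamma> \<subseteq> k_points k G" using subgroup.subset[OF assms(6)] by simp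
  then have \<Gamma>G: "\<Gamma> \<subseteq> G" by (auto simp: k_points_def)
  let ?A = "(\<lambda>x. \<phi> (x, \<one>\<^bsub>\<Gamma>2\<^esub>)) ` carrier \<Gamma>1" and ?B = "(\<lambda>y. \<phi> (\<one>\<^bsub>\<Gamma>1\<^esub>, y)) ` carrier \<Gamma>2"
  have \<phi>\<Gamma>: "\<phi> (x, y) \<in> \<Gamma>" if "x \<in> carrier \<Gamma>1" "y \<in> carrier \<Gamma>2" for x y
    using hom that by (auto simp: hom_def)
  have \<phi>mult: "\<phi> (x \<otimes>\<^bsub>\<Gamma>1\<^esub> x', y \<otimes>\<^bsub>\<Gamma>2\<^esub> y') = \<phi> (x, y) ** \<phi> (x', y')"
    if "x \<in> carrier \<Gamma>1" "x' \<in> carrier \<Gamma>1" "y \<in> carrier \<Gamma>2" "y' \<in> carrier \<Gamma>2" for x x' y y'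
    using hom_mult[OF hom, of "(x, y)" "(x', y')"] that by (simp add: GL_def)
  have "(\<lambda>x. \<phi> (x, \<one>\<^bsub>\<Gamma>2\<^esub>)) \<in> hom \<Gamma>1 GL"
  proof (rule homI)
    fix x x' assume "x \<in> carrier \<Gamma>1" "x' \<in> carrier \<Gamma>1"
    then show "\<phi> (x \<otimes>\<^bsub>\<Gamma>1\<^esub> x', \<one>\<^bsub>\<Gamma>2\<^esub>) = \<phi> (x, \<one>\<^bsub>\<Gamma>2\<^esub>) \<otimes>\<^bsub>GL\<^esub> \<phi> (x', \<one>\<^bsub>\<Gamma>2\<^esub>)"
      using \<phi>mult[of x x' "\<one>\<^bsub>\<Gamma>2\<^esub>" "\<one>\<^bsub>\<Gamma>2\<^esub>"] by simp
  qed (use \<phi>\<Gamma> \<Gamma>G GGL in blast)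
  then have A: "subgroup ?A GL"
    by (intro group_hom.img_is_subgroup group_hom.intro group_hom_axioms.intro gr group_GL)
  have "(\<lambda>y. \<phi> (\<one>\<^bsub>\<Gamma>1\<^esub>, y)) \<in> hom \<Gamma>2 GL"
  proof (rule homI)
    fix y y' assume "y \<in> carrier \<Gamma>2" "y' \<in> carrier \<Gamma>2"
    then show "\<phi> (\<one>\<^bsub>\<Gamma>1\<^esub>, y \<otimes>\<^bsub>\<Gamma>2\<^esub> y') = \<phi> (\<one>\<^bsub>\<Gamma>1\<^esub>, y) \<otimes>\<^bsub>GL\<^esub> \<phi> (\<one>\<^bsub>\<Gamma>1\<^esub>, y')"
      using \<phi>mult[of "\<one>\<^bsub>\<Gamma>1\<^esub>" "\<one>\<^bsub>\<Gamma>1\<^esub>" y y'] by simp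
  qed (use \<phi>\<Gamma> \<Gamma>G GGL in blast)
  then have B: "subgroup ?B GL"
    by (intro group_hom.img_is_subgroup group_hom.intro group_hom_axioms.intro gr group_GL)
  have AB: "\<phi> (x, \<one>\<^bsub>\<Gamma>2\<^esub>) ** \<phi> (\<one>\<^bsub>\<Gamma>1\<^esub>, y) = \<phi> (x, y)" "\<phi> (\<one>\<^bsub>\<Gamma>1\<^esub>, y) ** \<phi> (x, \<one>\<^bsub>\<Gamma>2\<^esub>) = \<phi> (x, y)"
    if "x \<in> carrier \<Gamma>1" "y \<in> carrier \<Gamma>2" for x y
    using that \<phi>mult[of x "\<one>\<^bsub>\<Gamma>1\<^esub>" "\<one>\<^bsub>\<Gamma>2\<^esub>" y] \<phi>mult[of "\<one>\<^bsub>\<Gamma>1\<^esub>" x y "\<one>\<^bsub>\<Gamma>2\<^esub>"] by simp_all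
  have comm: "a ** b = b ** a" if "a \<in> ?A" "b \<in> ?B" for a b
    using that AB by auto
  let ?P = "(\<lambda>(a, b). a ** b) ` (?A \<times> ?B)"
  have P: "subgroup ?P GL" by (rule subgroup_commuting_product[OF A B comm])
  have P_eq: "\<phi> ` carrier (\<Gamma>1 \<times>\<times> \<Gamma>2) = ?P"
  proof -
    have "?P = (\<lambda>(x, y). \<phi> (x, \<one>\<^bsub>\<Gamma>2\<^esub>) ** \<phi> (\<one>\<^bsub>\<Gamma>1\<^esub>, y)) ` (carrier \<Gamma>1 \<times> carrier \<Gamma>2)" by force
    also have "\<dots> = \<phi> ` (carrier \<Gamma>1 \<times> carrier \<Gamma>2)"
      by (intro image_cong refl) (auto simp: AB)
    finally show ?thesis by simp
  qed
  obtain A' where A': "subgroup A' GL" "A' \<subseteq> ?A" "finite_index A' ?A" "irreducible_set A'"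
    using ex_irreducible_finite_index[OF A] by blast
  obtain B' where B': "subgroup B' GL" "B' \<subseteq> ?B" "finite_index B' ?B" "irreducible_set B'"
    using ex_irreducible_finite_index[OF B] by blast
  have comm': "a ** b = b ** a" if "a \<in> A'" "b \<in> B'" for a b
    using comm that A'(2) B'(2) by blast
  let ?P' = "(\<lambda>(a, b). a ** b) ` (A' \<times> B')"
  have P': "subgroup ?P' GL" by (rule subgroup_commuting_product[OF A'(1) B'(1) comm'])
  have \<Gamma>sub: "?A \<subseteq> \<Gamma>" "?B \<subseteq> \<Gamma>" using \<phi>\<Gamma> by auto
  let ?G1 = "zcl A' \<inter> carrier GL" and ?G2 = "zcl B' \<inter> carrier GL"
  have sub: "V \<subseteq> zcl V \<inter> carrier GL" if "subgroup V GL" for V :: "('a^'n^'n) set"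
    using subset_zcl[of V] subgroup.subset[OF that] by blast
  \<comment> \<open>\<open>G\<close> is closed relative to \<open>GL\<close>, whereas
    \<open>zcl\<close> refers to all matrices; \<open>C\<close> mediates between the two.\<close>
  obtain C where C: "closedin zariski C" "G = C \<inter> carrier GL"
    using G(2) by (auto simp: closedin_subtopology)
  have zclG: "zcl V \<inter> carrier GL \<subseteq> G" if "V \<subseteq> \<Gamma>" for V
    using zcl_minimal[of V C] C that \<Gamma>G by blast
  have alg: "linear_algebraic_group k (zcl V \<inter> carrier GL)" "zcl V \<inter> carrier GL \<subseteq> G"
      "connectedin zariski (zcl V \<inter> carrier GL)" "zariski_dim (zcl V \<inter> carrier GL) > 0"
    if V: "subgroup V GL" "V \<subseteq> \<Gamma>" "irreducible_set V" "infinite V" for V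
  proof -
    show "linear_algebraic_group k (zcl V \<inter> carrier GL)"
      by (rule linear_algebraic_group_zcl[OF assms(1) V(1)])
        (use V(2) \<Gamma>k in \<open>auto simp: k_points_def\<close>)
    show "zcl V \<inter> carrier GL \<subseteq> G" by (rule zclG[OF V(2)])
    have irr: "irreducible_set (zcl V \<inter> carrier GL)"
      using irreducible_set_cong[OF sub[OF V(1)]] V(3) by blast
    then show "connectedin zariski (zcl V \<inter> carrier GL)" by (rule connectedin_irreducible_set)
    have "infinite (zcl V \<inter> carrier GL)" using V(4) sub[OF V(1)] finite_subset by blast
    with irr show "zariski_dim (zcl V \<inter> carrier GL) > 0" by (rule zariski_dim_pos)
  qed
  have "\<phi> ` (carrier \<Gamma>1 \<times> {\<one>\<^bsub>\<Gamma>2\<^esub>}) = ?A" "\<phi> ` ({\<one>\<^bsub>\<Gamma>1\<^esub>} \<times> carrier \<Gamma>2) = ?B" by auto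
  then have inf': "infinite A'" "infinite B'"
    using inf finite_index_infinite A'(3) B'(3) by metis+
  have "A' \<subseteq> \<Gamma>" "B' \<subseteq> \<Gamma>" using A'(2) B'(2) \<Gamma>sub by blast+
  note alg1 = alg[OF A'(1) this(1) A'(4) inf'(1)] and alg2 = alg[OF B'(1) this(2) B'(4) inf'(2)]
  have comm12: "\<forall>a\<in>?G1. \<forall>b\<in>?G2. a ** b = b ** a"
    using zcl_commute[of A' B'] comm' by blast
  have "(\<lambda>(a, b). a ** b) ` (?G1 \<times> ?G2) = G"
  proof
    show "(\<lambda>(a, b). a ** b) ` (?G1 \<times> ?G2) \<subseteq> G"
    proof clarify
      fix a b assume "a \<in> zcl A'" "a \<in> carrier GL" "b \<in> zcl B'" "b \<in> carrier GL"
      then have "a \<in> G" "b \<in> G" using alg1(2) alg2(2) by blast+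
      then show "a ** b \<in> G" using G(1) unfolding subgroup_GL_iff by blast
    qed
    obtain T where T: "finite T" "T \<subseteq> \<Gamma>" "\<Gamma> \<subseteq> (\<Union>t\<in>T. (\<lambda>p. p ** t) ` ?P)"
      using finite_rcosets_reps[of \<Gamma> ?P] fin P unfolding P_eq subgroup_GL_iff by blast
    obtain S where S: "finite S" "S \<subseteq> ?P" "?P \<subseteq> (\<Union>s\<in>S. (\<lambda>p. p ** s) ` ?P')"
      using finite_index_right_reps[OF P P'
          finite_index_commuting_product[OF A'(3) B'(3) A'(2) comm]] by blast
    \<comment> \<open>\<open>\<Gamma>\<close> is covered by the cosets \<open>?P ** t\<close> and
      \<open>?P\<close> by the cosets \<open>?P' ** s\<close>, which fixes the order
      \<open>s ** t\<close>.\<close>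
    let ?T = "(\<lambda>(s, t). s ** t) ` (S \<times> T)"
    have "\<Gamma> \<subseteq> (\<Union>u\<in>?T. (\<lambda>p. p ** u) ` ?P')"
    proof
      fix g assume "g \<in> \<Gamma>"
      from subsetD[OF T(3) this] obtain t where t: "t \<in> T" "g \<in> (\<lambda>p. p ** t) ` ?P" by (rule UN_E)
      from t(2) obtain p where p: "g = p ** t" "p \<in> ?P" by (rule imageE)
      from subsetD[OF S(3) p(2)] obtain s where s: "s \<in> S" "p \<in> (\<lambda>p. p ** s) ` ?P'" by (rule UN_E)
      from s(2) obtain q where q: "p = q ** s" "q \<in> ?P'" by (rule imageE)
      have "g = q ** (s ** t)" unfolding p(1) q(1) by (simp add: matrix_mul_assoc)
      then show "g \<in> (\<Union>u\<in>?T. (\<lambda>p. p ** u) ` ?P')" using s(1) q(2) t(1) by blast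
    qed
    moreover have "G \<subseteq> zcl \<Gamma>"
      using assms(7) closure_of_subtopology_subset[of zariski G \<Gamma>] unfolding zariski_dense_def by blast
    ultimately have "G \<subseteq> zcl (\<Union>u\<in>?T. (\<lambda>p. p ** u) ` ?P')"
      using closure_of_mono by blast
    moreover have "?T \<subseteq> carrier GL"
    proof -
      have "S \<subseteq> carrier GL" using S(2) subgroup.subset[OF P] by blast
      moreover have "T \<subseteq> carrier GL" using T(2) \<Gamma>G GGL by blast
      ultimately show ?thesis by (auto simp: carrier_GL subset_iff intro: invertible_mult)
    qed
    moreover have "mat 1 \<in> G" "finite ?T" using G(1) S(1) T(1) by (auto simp: subgroup_GL_iff)
    ultimately have "G \<subseteq> zcl ?P'"
      using connected_subset_zcl[OF assms(4) GGL _ P'] by blast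
    then show "G \<subseteq> (\<lambda>(a, b). a ** b) ` (?G1 \<times> ?G2)"
      using closed_product[OF A'(1,4) B'(1,4) comm'] GGL by blast
  qed
  then have "alg_presentable_by_product k G"
    unfolding alg_presentable_by_product_def using alg1 alg2 comm12
    by (intro exI[of _ ?G1] exI[of _ ?G2] conjI)
  then show False using assms(5) by contradiction
qed

end
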